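(* Let $\Bbbk$ be a field, $G$ a group with neutral element $e$, $n$ a positive integer, $\mathbb{I}_n=\{1,\dots,n\}$, and let $R=({}_iM_j)_{i,j\in\mathbb{I}_n}$ be a generalized matrix algebra over $\Bbbk$ with diagonal algebras $R_i={}_iM_i$, whose unit elements are denoted $1_i$. The following assertions are equivalent: (i) there is a unital datum $\mathcal{D}=\big(\{\alpha^{(i)}\}_{i\in\mathbb{I}_n},\{\gamma_g\}_{g\in G}\big)$ for $R$; (ii) the Hopf algebra $H=\Bbbk G$ satisfies the following conditions: (a)' for each $i\in\mathbb{I}_n$ there is a left partial action $\rightharpoonup_i:\Bbbk G\otimes R_i\to R_i$ of $\Bbbk G$ on $R_i$ such that, writing $1^{(i)}_g:=g\rightharpoonup_i 1_i$, one has $1^{(i)}_g m=m1^{(j)}_g$ for all $m\in{}_iM_j$, $g\in G$ and $i,j\in\mathbb{I}_n$; (b) for all $i,j\in\mathbb{I}_n$, ${}_iM_j$ is a left $\underline{R_i\#H}$-module and a right $\underline{H^{\mathrm{op}}\#R_j}$-module (the partial smash products being formed with respect to the partial actions in (a)') such that $$(1_i\#h)\cdot m=m\cdot(h\#1_j),\quad (1_i\#h)\cdot r=h\rightharpoonup_i r,\quad (r_i\#1_H)\cdot m=r_i\cdot m,\quad m\cdot(1_H\#r_j)=m\cdot r_j,$$ for all $h\in H$, $m\in{}_iM_j$, $r,r_i\in R_i$, $r_j\in R_j$ (in the second identity $r$ is regarded as an element of the left $\underline{R_i\#H}$-module ${}_iM_i=R_i$); (c) $(1_i\#h)\cdot mn=\big((1_i\#h_{(1)})\cdot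 m\big)\big((1_j\#h_{(2)})\cdot n\big)$ for all $h\in H$, $m\in{}_iM_j$, $n\in{}_jM_k$ and $i,j,k\in\mathbb{I}_n$.
   Context: Conventions: algebras are associative unital $\Bbbk$-algebras; tensor products are over $\Bbbk$; $\Delta(h)=h_{(1)}\otimes h_{(2)}$ (for $g\in G$, $\Delta(g)=g\otimes g$ in $\Bbbk G$). $H^{\mathrm{op}}$ is $H$ with the opposite multiplication and the same comultiplication. Generalized matrix algebra: one is given vector spaces ${}_iM_j$, linear maps $\theta_{ijk}:{}_iM_j\otimes{}_jM_k\to{}_iM_k$ and $\eta_i:\Bbbk\to{}_iM_i$ with $\theta_{ikl}\circ(\theta_{ijk}\otimes\mathrm{id})=\theta_{ijl}\circ(\mathrm{id}\otimes\theta_{jkl})$ and $\theta_{iij}\circ(\eta_i\otimes\mathrm{id})=\mathrm{id}=\theta_{ijj}\circ(\mathrm{id}\otimes\eta_j)$ on ${}_iM_j$. Then $R_i={}_iM_i$ is a unital algebra with unit $1_i=\eta_i(1)$, ${}_iM_j$ is an $(R_i,R_j)$-bimodule, and $R=\bigoplus_{i,j}{}_iM_j$ is a unital algebra of matrices $(x_{ij})$ with row-column multiplication using the products $mn:=\theta_{ijk}(m\otimes n)$. Left partial action (always symmetric) of $H$ on $A$: a linear map $H\otimes A\to A$, $h\otimes a\mapsto h\cdot a$, with $1_H\cdot a=a$; $h\cdot(ab)=(h_{(1)}\cdot a)(h_{(2)}\cdot b)$; $h\cdot(k\cdot a)=(h_{(1)}\cdot1_A)(h_{(2)}k\cdot a)=(h_{(1)}k\cdot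 a)(h_{(2)}\cdot1_A)$. It induces a right partial action of $H^{\mathrm{op}}$ on $A$ by $a\triangleleft h=h\cdot a$. Left partial smash product: $A\otimes H$ has product $(a\otimes h)(b\otimes k)=a(h_{(1)}\cdot b)\otimes h_{(2)}k$, and $\underline{A\#H}=(A\otimes H)(1_A\otimes1_H)$ is the unital algebra spanned by $a\#h=a(h_{(1)}\cdot1_A)\otimes h_{(2)}$, with unit $1_A\#1_H$. Right partial smash product: $H^{\mathrm{op}}\otimes A$ has product $(k\otimes b)(h\otimes a)=(k\cdot_{\mathrm{op}}h_{(1)})\otimes(b\triangleleft h_{(2)})a$, where $k\cdot_{\mathrm{op}}h=hk$, and $\underline{H^{\mathrm{op}}\#A}=(1_H\otimes1_A)(H^{\mathrm{op}}\otimes A)$ is the unital algebra spanned by $h\#a=h_{(1)}\otimes(1_A\triangleleft h_{(2)})a$, with unit $1_H\#1_A$. Partial group action of $G$ on an algebra $A$: $\alpha=(D_g,\alpha_g)_{g\in G}$ with $D_g$ two-sided ideals of $A$ and $\alpha_g:D_{g^{-1}}\to D_g$ algebra isomorphisms such that $D_e=A$, $\alpha_e=\mathrm{id}_A$, $\alpha_h^{-1}(D_{g^{-1}}\cap D_h)\subset D_{(gh)^{-1}}$, and $\alpha_g(\alpha_h(a))=\alpha_{gh}(a)$ for $a\in\alpha_h^{-1}(D_{g^{-1}}\cap D_h)$. It is unital if each $D_g$ has an identity element (equivalently, is generated by a central idempotent of $A$). Datum: let $\alpha^{(i)}=(D^{(i)}_g,\alpha^{(i)}_g)_{g\in G}$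 be a partial action of $G$ on $R_i$ for each $i$, and suppose that $D^{(i)}_g\,{}_iM_j={}_iM_j\,D^{(j)}_g$ for all $i,j\in\mathbb{I}_n$, $g\in G$. For each $g\in G$ let $\gamma_g=\{\gamma^{(ij)}_g:D^{(i)}_{g^{-1}}\,{}_iM_j\to D^{(i)}_g\,{}_iM_j\}_{i,j\in\mathbb{I}_n}$ be a collection of $\Bbbk$-linear bijections. The pair $\mathcal{D}=(\{\alpha^{(i)}\}_{i\in\mathbb{I}_n},\{\gamma_g\}_{g\in G})$ is a datum for $R$ if for all $g,h\in G$, $i,j,k\in\mathbb{I}_n$: - $\gamma^{(ii)}_g=\alpha^{(i)}_g$ and $\gamma^{(ij)}_e=\mathrm{id}_{{}_iM_j}$; - $\gamma^{(ik)}_g(u)\gamma^{(kj)}_g(v)=\gamma^{(ij)}_g(uv)$ for all $u\in D^{(i)}_{g^{-1}}\,{}_iM_k$, $v\in D^{(k)}_{g^{-1}}\,{}_kM_j$; - $(\gamma^{(ij)}_h)^{-1}\big(D^{(i)}_{g^{-1}}\,{}_iM_j\cap D^{(i)}_h\,{}_iM_j\big)\subset D^{(i)}_{(gh)^{-1}}\,{}_iM_j$; - $\gamma^{(ij)}_g(\gamma^{(ij)}_h(a))=\gamma^{(ij)}_{gh}(a)$ for all $a\in(\gamma^{(ij)}_h)^{-1}\big(D^{(i)}_{g^{-1}}\,{}_iM_j\cap D^{(i)}_h\,{}_iM_j\big)$. The symmetry hypothesis implies that $I_g=\big(D^{(i)}_g\,{}_iM_j\big)_{i,j\in\mathbb{I}_n}$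 is an ideal of $R$. The datum is unital if every $\alpha^{(i)}$ is unital, with $1^{(i)}_g$ the identity element of $D^{(i)}_g$, and for every $g\in G$ the ideal $I_g$ is unital with identity element $1_g=\operatorname{diag}(1^{(1)}_g,\ldots,1^{(n)}_g)$. *)

theory Defs
  imports Complex_Main "HOL-Library.Poly_Mapping"
begin

text \<open>
  Groups are types of class \<open>group_add\<close>, which does not assume commutativity: the product
  of \<open>g\<close> and \<open>h\<close> is written \<open>g + h\<close>, the neutral element \<open>0\<close> and the inverse \<open>- g\<close>.
  Then \<open>'g \<Rightarrow>\<^sub>0 'k\<close> with its library (convolution) multiplication is the group algebra,
  and \<open>Poly_Mapping.single g 1\<close> is the group element \<open>g\<close> in it.
  Vector spaces are subspaces of an ambient space \<open>'a\<close> with scalar multiplication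
  \<open>s :: 'k \<Rightarrow> 'a \<Rightarrow> 'a\<close>; maps between them matter only on these subspaces.
\<close>

subsection \<open>Linear algebra on subspaces\<close>

definition linear_on ::
  "('k \<Rightarrow> 'a \<Rightarrow> 'a) \<Rightarrow> ('k \<Rightarrow> 'b \<Rightarrow> 'b) \<Rightarrow> 'a::ab_group_add set \<Rightarrow> 'b::ab_group_add set
    \<Rightarrow> ('a \<Rightarrow> 'b) \<Rightarrow> bool" where
  "linear_on s t V W f \<longleftrightarrow>
     (\<forall>x\<in>V. f x \<in> W) \<and>
     (\<forall>x\<in>V. \<forall>y\<in>V. f (x + y) = f x + f y) \<and>
     (\<forall>c. \<forall>x\<in>V. f (s c x) = t c (f x))"

definition bilinear_on ::
  "('k \<Rightarrow> 'a \<Rightarrow> 'a) \<Rightarrow> ('k \<Rightarrow> 'b \<Rightarrow> 'b) \<Rightarrow> ('k \<Rightarrow> 'c \<Rightarrow> 'c)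
    \<Rightarrow> 'a::ab_group_add set \<Rightarrow> 'b::ab_group_add set \<Rightarrow> 'c::ab_group_add set
    \<Rightarrow> ('a \<Rightarrow> 'b \<Rightarrow> 'c) \<Rightarrow> bool" where
  "bilinear_on s t r U V W f \<longleftrightarrow>
     (\<forall>x\<in>U. linear_on t r V W (f x)) \<and> (\<forall>y\<in>V. linear_on s r U W (\<lambda>x. f x y))"

definition span_products ::
  "('k::field \<Rightarrow> 'c \<Rightarrow> 'c) \<Rightarrow> ('a \<Rightarrow> 'b \<Rightarrow> 'c::ab_group_add) \<Rightarrow> 'a set \<Rightarrow> 'b set \<Rightarrow> 'c set" where
  "span_products s f U V = module.span s {f u v | u v. u \<in> U \<and> v \<in> V}"


subsection \<open>Algebras and modules\<close>

record ('k, 'a) alg =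
  alg_scale :: "'k \<Rightarrow> 'a \<Rightarrow> 'a"
  alg_carrier :: "'a set"
  alg_mult :: "'a \<Rightarrow> 'a \<Rightarrow> 'a"
  alg_one :: "'a"

definition left_module ::
  "('k, 'a::ab_group_add) alg \<Rightarrow> ('k \<Rightarrow> 'v \<Rightarrow> 'v) \<Rightarrow> 'v::ab_group_add set
    \<Rightarrow> ('a \<Rightarrow> 'v \<Rightarrow> 'v) \<Rightarrow> bool" where
  "left_module A s V L \<longleftrightarrow>
     bilinear_on (alg_scale A) s s (alg_carrier A) V V L \<and>
     (\<forall>x\<in>alg_carrier A. \<forall>y\<in>alg_carrier A. \<forall>v\<in>V. L (alg_mult A x y) v = L x (L y v)) \<and>
     (\<forall>v\<in>V. L (alg_one A) v = v)"

definition right_module ::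
  "('k, 'a::ab_group_add) alg \<Rightarrow> ('k \<Rightarrow> 'v \<Rightarrow> 'v) \<Rightarrow> 'v::ab_group_add set
    \<Rightarrow> ('v \<Rightarrow> 'a \<Rightarrow> 'v) \<Rightarrow> bool" where
  "right_module A s V Q \<longleftrightarrow>
     bilinear_on s (alg_scale A) s V (alg_carrier A) V Q \<and>
     (\<forall>x\<in>alg_carrier A. \<forall>y\<in>alg_carrier A. \<forall>v\<in>V. Q v (alg_mult A x y) = Q (Q v x) y) \<and>
     (\<forall>v\<in>V. Q v (alg_one A) = v)"

definition two_sided_ideal :: "('k::field, 'a::ab_group_add) alg \<Rightarrow> 'a set \<Rightarrow> bool" where
  "two_sided_ideal A D \<longleftrightarrow>
     module.subspace (alg_scale A) D \<and> D \<subseteq> alg_carrier A \<and>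
     (\<forall>a\<in>alg_carrier A. \<forall>d\<in>D. alg_mult A a d \<in> D \<and> alg_mult A d a \<in> D)"

definition is_identity_of :: "('a \<Rightarrow> 'a \<Rightarrow> 'a) \<Rightarrow> 'a set \<Rightarrow> 'a \<Rightarrow> bool" where
  "is_identity_of mult D u \<longleftrightarrow> u \<in> D \<and> (\<forall>d\<in>D. mult u d = d \<and> mult d u = d)"


subsection \<open>Partial actions of groups\<close>

definition partial_group_action ::
  "('k::field, 'a::ab_group_add) alg \<Rightarrow> ('g::group_add \<Rightarrow> 'a set) \<Rightarrow> ('g \<Rightarrow> 'a \<Rightarrow> 'a) \<Rightarrow> bool" where
  "partial_group_action A D \<alpha> \<longleftrightarrow>
     (\<forall>g. two_sided_ideal A (D g)) \<and>
     (\<forall>g. linear_on (alg_scale A) (alg_scale A) (D (- g)) (D g) (\<alpha> g) \<and>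
          bij_betw (\<alpha> g) (D (- g)) (D g) \<and>
          (\<forall>a\<in>D (- g). \<forall>b\<in>D (- g). \<alpha> g (alg_mult A a b) = alg_mult A (\<alpha> g a) (\<alpha> g b))) \<and>
     D 0 = alg_carrier A \<and>
     (\<forall>a\<in>alg_carrier A. \<alpha> 0 a = a) \<and>
     (\<forall>g h. {a \<in> D (- h). \<alpha> h a \<in> D (- g) \<inter> D h} \<subseteq> D (- (g + h))) \<and>
     (\<forall>g h. \<forall>a\<in>{a \<in> D (- h). \<alpha> h a \<in> D (- g) \<inter> D h}. \<alpha> g (\<alpha> h a) = \<alpha> (g + h) a)"


subsection \<open>Partial actions of group algebras and partial smash products\<close>

definition pm_scale :: "('k \<Rightarrow> 'a \<Rightarrow> 'a) \<Rightarrow> 'k \<Rightarrow> ('g \<Rightarrow>\<^sub>0 'a::zero) \<Rightarrow> ('g \<Rightarrow>\<^sub>0 'a)" where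
  "pm_scale s c x = Poly_Mapping.map (s c) x"

text \<open>
  \<open>sweedler s h B\<close> is \<open>B(h_1, h_2)\<close> in Sweedler notation, for bilinear \<open>B\<close> with values in a
  space with scalar multiplication \<open>s\<close>; the comultiplication of the group algebra is the
  linear extension of \<open>g \<mapsto> g \<otimes> g\<close>.
\<close>

definition sweedler ::
  "('k::field \<Rightarrow> 'b \<Rightarrow> 'b) \<Rightarrow> ('g \<Rightarrow>\<^sub>0 'k) \<Rightarrow> (('g \<Rightarrow>\<^sub>0 'k) \<Rightarrow> ('g \<Rightarrow>\<^sub>0 'k) \<Rightarrow> 'b::ab_group_add) \<Rightarrow> 'b" where
  "sweedler s h B =
     (\<Sum>g\<in>Poly_Mapping.keys h. s (Poly_Mapping.lookup h g)
        (B (Poly_Mapping.single g 1) (Poly_Mapping.single g 1)))"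

definition left_partial_action ::
  "('k::field, 'a::ab_group_add) alg \<Rightarrow> (('g::group_add \<Rightarrow>\<^sub>0 'k) \<Rightarrow> 'a \<Rightarrow> 'a) \<Rightarrow> bool" where
  "left_partial_action A act \<longleftrightarrow>
     bilinear_on (pm_scale (*)) (alg_scale A) (alg_scale A)
       UNIV (alg_carrier A) (alg_carrier A) act \<and>
     (\<forall>a\<in>alg_carrier A. act 1 a = a) \<and>
     (\<forall>h. \<forall>a\<in>alg_carrier A. \<forall>b\<in>alg_carrier A.
        act h (alg_mult A a b)
          = sweedler (alg_scale A) h (\<lambda>h1 h2. alg_mult A (act h1 a) (act h2 b))) \<and>
     (\<forall>h k. \<forall>a\<in>alg_carrier A.
        act h (act k a)
          = sweedler (alg_scale A) h (\<lambda>h1 h2. alg_mult A (act h1 (alg_one A)) (act (h2 * k) a)) \<and>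
        act h (act k a)
          = sweedler (alg_scale A) h (\<lambda>h1 h2. alg_mult A (act (h1 * k) a) (act h2 (alg_one A))))"

text \<open>
  As the group elements form a basis of the group algebra \<open>H\<close>, both \<open>A \<otimes> H\<close> and \<open>H \<otimes> A\<close>
  are the finitely supported functions from the group to \<open>A\<close>: \<open>x\<close> stands for the sum of
  all \<open>x(g) \<otimes> g\<close>, respectively \<open>g \<otimes> x(g)\<close>. The term \<open>tensor A a h\<close> stands for \<open>a \<otimes> h\<close>,
  respectively \<open>h \<otimes> a\<close>.
\<close>

definition tensor_space :: "('k, 'a::zero) alg \<Rightarrow> ('g \<Rightarrow>\<^sub>0 'a) set" where
  "tensor_space A = {x. \<forall>g. Poly_Mapping.lookup x g \<in> alg_carrier A}"

definition tensor :: "('k::zero, 'a::zero) alg \<Rightarrow> 'a \<Rightarrow> ('g \<Rightarrow>\<^sub>0 'k) \<Rightarrow> ('g \<Rightarrow>\<^sub>0 'a)" where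
  "tensor A a h = Poly_Mapping.map (\<lambda>c. alg_scale A c a) h"

text \<open>
  Bilinear extension of \<open>(a \<otimes> h)(b \<otimes> k) = a (h_1 \<cdot> b) \<otimes> h_2 k\<close>, applied to
  \<open>x = \<Sum> x(g) \<otimes> g\<close> and \<open>y = \<Sum> y(l) \<otimes> l\<close>.
\<close>

definition left_smash_mult ::
  "('k::field, 'a::ab_group_add) alg \<Rightarrow> (('g::group_add \<Rightarrow>\<^sub>0 'k) \<Rightarrow> 'a \<Rightarrow> 'a)
    \<Rightarrow> ('g \<Rightarrow>\<^sub>0 'a) \<Rightarrow> ('g \<Rightarrow>\<^sub>0 'a) \<Rightarrow> ('g \<Rightarrow>\<^sub>0 'a)" where
  "left_smash_mult A act x y =
     (\<Sum>g\<in>Poly_Mapping.keys x. \<Sum>l\<in>Poly_Mapping.keys y.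
        sweedler (pm_scale (alg_scale A)) (Poly_Mapping.single g 1)
          (\<lambda>h1 h2. tensor A
             (alg_mult A (Poly_Mapping.lookup x g) (act h1 (Poly_Mapping.lookup y l)))
             (h2 * Poly_Mapping.single l 1)))"

definition left_smash_elem ::
  "('k::field, 'a::ab_group_add) alg \<Rightarrow> (('g::group_add \<Rightarrow>\<^sub>0 'k) \<Rightarrow> 'a \<Rightarrow> 'a)
    \<Rightarrow> 'a \<Rightarrow> ('g \<Rightarrow>\<^sub>0 'k) \<Rightarrow> ('g \<Rightarrow>\<^sub>0 'a)" where
  "left_smash_elem A act a h =
     sweedler (pm_scale (alg_scale A)) h
       (\<lambda>h1 h2. tensor A (alg_mult A a (act h1 (alg_one A))) h2)"

definition left_smash ::
  "('k::field, 'a::ab_group_add) alg \<Rightarrow> (('g::group_add \<Rightarrow>\<^sub>0 'k) \<Rightarrow> 'a \<Rightarrow> 'a)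
    \<Rightarrow> ('k, 'g \<Rightarrow>\<^sub>0 'a) alg" where
  "left_smash A act =
     \<lparr> alg_scale = pm_scale (alg_scale A),
       alg_carrier = (\<lambda>x. left_smash_mult A act x (tensor A (alg_one A) 1)) ` tensor_space A,
       alg_mult = left_smash_mult A act,
       alg_one = left_smash_elem A act (alg_one A) 1 \<rparr>"

text \<open>
  The right partial smash product takes a right action \<open>ract\<close> of the opposite algebra;
  the product is the bilinear extension of
  \<open>(k \<otimes> b)(h \<otimes> a) = (k \<cdot>op h_1) \<otimes> (b \<triangleleft> h_2) a\<close>.
\<close>

definition op_mult :: "('g::group_add \<Rightarrow>\<^sub>0 'k::field) \<Rightarrow> ('g \<Rightarrow>\<^sub>0 'k) \<Rightarrow> ('g \<Rightarrow>\<^sub>0 'k)" where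
  "op_mult k h = h * k"

definition induced_right_action :: "('h \<Rightarrow> 'a \<Rightarrow> 'a) \<Rightarrow> 'a \<Rightarrow> 'h \<Rightarrow> 'a" where
  "induced_right_action act a h = act h a"

definition right_smash_mult ::
  "('k::field, 'a::ab_group_add) alg \<Rightarrow> ('a \<Rightarrow> ('g::group_add \<Rightarrow>\<^sub>0 'k) \<Rightarrow> 'a)
    \<Rightarrow> ('g \<Rightarrow>\<^sub>0 'a) \<Rightarrow> ('g \<Rightarrow>\<^sub>0 'a) \<Rightarrow> ('g \<Rightarrow>\<^sub>0 'a)" where
  "right_smash_mult A ract x y =
     (\<Sum>g\<in>Poly_Mapping.keys x. \<Sum>l\<in>Poly_Mapping.keys y.
        sweedler (pm_scale (alg_scale A)) (Poly_Mapping.single l 1)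
          (\<lambda>h1 h2. tensor A
             (alg_mult A (ract (Poly_Mapping.lookup x g) h2) (Poly_Mapping.lookup y l))
             (op_mult (Poly_Mapping.single g 1) h1)))"

definition right_smash_elem ::
  "('k::field, 'a::ab_group_add) alg \<Rightarrow> ('a \<Rightarrow> ('g::group_add \<Rightarrow>\<^sub>0 'k) \<Rightarrow> 'a)
    \<Rightarrow> ('g \<Rightarrow>\<^sub>0 'k) \<Rightarrow> 'a \<Rightarrow> ('g \<Rightarrow>\<^sub>0 'a)" where
  "right_smash_elem A ract h a =
     sweedler (pm_scale (alg_scale A)) h
       (\<lambda>h1 h2. tensor A (alg_mult A (ract (alg_one A) h2) a) h1)"

definition right_smash ::
  "('k::field, 'a::ab_group_add) alg \<Rightarrow> ('a \<Rightarrow> ('g::group_add \<Rightarrow>\<^sub>0 'k) \<Rightarrow> 'a)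
    \<Rightarrow> ('k, 'g \<Rightarrow>\<^sub>0 'a) alg" where
  "right_smash A ract =
     \<lparr> alg_scale = pm_scale (alg_scale A),
       alg_carrier = (\<lambda>x. right_smash_mult A ract (tensor A (alg_one A) 1) x) ` tensor_space A,
       alg_mult = right_smash_mult A ract,
       alg_one = right_smash_elem A ract 1 (alg_one A) \<rparr>"


subsection \<open>Generalized matrix algebras\<close>

text \<open>
  The spaces of the family are subspaces of one ambient vector space (for instance of the
  direct sum of the family); they may overlap arbitrarily, so the products carry all their
  indices.
\<close>

record ('k, 'm) gma =
  gm_scale :: "'k \<Rightarrow> 'm \<Rightarrow> 'm"
  gm_size :: nat
  gm_entry :: "nat \<Rightarrow> nat \<Rightarrow> 'm set"
  gm_prod :: "nat \<Rightarrow> nat \<Rightarrow> nat \<Rightarrow> 'm \<Rightarrow> 'm \<Rightarrow> 'm"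
  gm_unit :: "nat \<Rightarrow> 'k \<Rightarrow> 'm"

definition gm_idx :: "('k, 'm) gma \<Rightarrow> nat set" where
  "gm_idx R = {1..gm_size R}"

definition generalized_matrix_algebra :: "('k::field, 'm::ab_group_add) gma \<Rightarrow> bool" where
  "generalized_matrix_algebra R \<longleftrightarrow>
     vector_space (gm_scale R) \<and>
     (\<forall>i\<in>gm_idx R. \<forall>j\<in>gm_idx R. module.subspace (gm_scale R) (gm_entry R i j)) \<and>
     (\<forall>i\<in>gm_idx R. \<forall>j\<in>gm_idx R. \<forall>k\<in>gm_idx R.
        bilinear_on (gm_scale R) (gm_scale R) (gm_scale R)
          (gm_entry R i j) (gm_entry R j k) (gm_entry R i k) (gm_prod R i j k)) \<and>
     (\<forall>i\<in>gm_idx R. linear_on (*) (gm_scale R) UNIV (gm_entry R i i) (gm_unit R i)) \<and>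
     (\<forall>i\<in>gm_idx R. \<forall>j\<in>gm_idx R. \<forall>k\<in>gm_idx R. \<forall>l\<in>gm_idx R.
        \<forall>x\<in>gm_entry R i j. \<forall>y\<in>gm_entry R j k. \<forall>z\<in>gm_entry R k l.
          gm_prod R i k l (gm_prod R i j k x y) z = gm_prod R i j l x (gm_prod R j k l y z)) \<and>
     (\<forall>i\<in>gm_idx R. \<forall>j\<in>gm_idx R. \<forall>m\<in>gm_entry R i j. \<forall>c.
        gm_prod R i i j (gm_unit R i c) m = gm_scale R c m \<and>
        gm_prod R i j j m (gm_unit R j c) = gm_scale R c m)"

definition gm_one :: "('k::field, 'm) gma \<Rightarrow> nat \<Rightarrow> 'm" where
  "gm_one R i = gm_unit R i 1"

definition gm_diag :: "('k::field, 'm) gma \<Rightarrow> nat \<Rightarrow> ('k, 'm) alg" where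
  "gm_diag R i =
     \<lparr> alg_scale = gm_scale R, alg_carrier = gm_entry R i i,
       alg_mult = gm_prod R i i i, alg_one = gm_one R i \<rparr>"

text \<open>Matrices are functions \<open>nat \<Rightarrow> nat \<Rightarrow> 'm\<close> that vanish outside the index range.\<close>

definition matrices_over ::
  "('k, 'm) gma \<Rightarrow> (nat \<Rightarrow> nat \<Rightarrow> 'm set) \<Rightarrow> (nat \<Rightarrow> nat \<Rightarrow> 'm::zero) set" where
  "matrices_over R N =
     {x. \<forall>i j. (i \<in> gm_idx R \<and> j \<in> gm_idx R \<longrightarrow> x i j \<in> N i j) \<and>
               (\<not> (i \<in> gm_idx R \<and> j \<in> gm_idx R) \<longrightarrow> x i j = 0)}"

definition gm_matrix_mult ::
  "('k, 'm::comm_monoid_add) gma \<Rightarrow> (nat \<Rightarrow> nat \<Rightarrow> 'm) \<Rightarrow> (nat \<Rightarrow> nat \<Rightarrow> 'm) \<Rightarrow> nat \<Rightarrow> nat \<Rightarrow> 'm" where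
  "gm_matrix_mult R x y = (\<lambda>i j.
     if i \<in> gm_idx R \<and> j \<in> gm_idx R then \<Sum>k\<in>gm_idx R. gm_prod R i k j (x i k) (y k j) else 0)"

definition gm_diagonal_matrix :: "('k, 'm::zero) gma \<Rightarrow> (nat \<Rightarrow> 'm) \<Rightarrow> nat \<Rightarrow> nat \<Rightarrow> 'm" where
  "gm_diagonal_matrix R d = (\<lambda>i j. if i \<in> gm_idx R \<and> i = j then d i else 0)"


subsection \<open>Data\<close>

definition ideal_entry ::
  "('k::field, 'm::ab_group_add) gma \<Rightarrow> (nat \<Rightarrow> 'g \<Rightarrow> 'm set) \<Rightarrow> 'g \<Rightarrow> nat \<Rightarrow> nat \<Rightarrow> 'm set" where
  "ideal_entry R D g i j = span_products (gm_scale R) (gm_prod R i i j) (D i g) (gm_entry R i j)"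

definition entry_ideal ::
  "('k::field, 'm::ab_group_add) gma \<Rightarrow> (nat \<Rightarrow> 'g \<Rightarrow> 'm set) \<Rightarrow> 'g \<Rightarrow> nat \<Rightarrow> nat \<Rightarrow> 'm set" where
  "entry_ideal R D g i j = span_products (gm_scale R) (gm_prod R i j j) (gm_entry R i j) (D j g)"

definition datum ::
  "('k::field, 'm::ab_group_add) gma \<Rightarrow> (nat \<Rightarrow> 'g::group_add \<Rightarrow> 'm set)
    \<Rightarrow> (nat \<Rightarrow> 'g \<Rightarrow> 'm \<Rightarrow> 'm) \<Rightarrow> ('g \<Rightarrow> nat \<Rightarrow> nat \<Rightarrow> 'm \<Rightarrow> 'm) \<Rightarrow> bool" where
  "datum R D \<alpha> \<gamma> \<longleftrightarrow>
     (\<forall>i\<in>gm_idx R. partial_group_action (gm_diag R i) (D i) (\<alpha> i)) \<and>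
     (\<forall>g. \<forall>i\<in>gm_idx R. \<forall>j\<in>gm_idx R. ideal_entry R D g i j = entry_ideal R D g i j) \<and>
     (\<forall>g. \<forall>i\<in>gm_idx R. \<forall>j\<in>gm_idx R.
        linear_on (gm_scale R) (gm_scale R)
          (ideal_entry R D (- g) i j) (ideal_entry R D g i j) (\<gamma> g i j) \<and>
        bij_betw (\<gamma> g i j) (ideal_entry R D (- g) i j) (ideal_entry R D g i j)) \<and>
     (\<forall>g. \<forall>i\<in>gm_idx R. \<forall>x\<in>D i (- g). \<gamma> g i i x = \<alpha> i g x) \<and>
     (\<forall>i\<in>gm_idx R. \<forall>j\<in>gm_idx R. \<forall>m\<in>gm_entry R i j. \<gamma> 0 i j m = m) \<and>
     (\<forall>g. \<forall>i\<in>gm_idx R. \<forall>j\<in>gm_idx R. \<forall>k\<in>gm_idx R.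
        \<forall>u\<in>ideal_entry R D (- g) i k. \<forall>v\<in>ideal_entry R D (- g) k j.
          gm_prod R i k j (\<gamma> g i k u) (\<gamma> g k j v) = \<gamma> g i j (gm_prod R i k j u v)) \<and>
     (\<forall>g h. \<forall>i\<in>gm_idx R. \<forall>j\<in>gm_idx R.
        {a \<in> ideal_entry R D (- h) i j.
           \<gamma> h i j a \<in> ideal_entry R D (- g) i j \<inter> ideal_entry R D h i j}
        \<subseteq> ideal_entry R D (- (g + h)) i j) \<and>
     (\<forall>g h. \<forall>i\<in>gm_idx R. \<forall>j\<in>gm_idx R.
        \<forall>a\<in>{a \<in> ideal_entry R D (- h) i j.
              \<gamma> h i j a \<in> ideal_entry R D (- g) i j \<inter> ideal_entry R D h i j}.
          \<gamma> g i j (\<gamma> h i j a) = \<gamma> (g + h) i j a)"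

definition unital_datum ::
  "('k::field, 'm::ab_group_add) gma \<Rightarrow> (nat \<Rightarrow> 'g::group_add \<Rightarrow> 'm set)
    \<Rightarrow> (nat \<Rightarrow> 'g \<Rightarrow> 'm \<Rightarrow> 'm) \<Rightarrow> ('g \<Rightarrow> nat \<Rightarrow> nat \<Rightarrow> 'm \<Rightarrow> 'm) \<Rightarrow> bool" where
  "unital_datum R D \<alpha> \<gamma> \<longleftrightarrow>
     datum R D \<alpha> \<gamma> \<and>
     (\<exists>u :: nat \<Rightarrow> 'g \<Rightarrow> 'm.
        (\<forall>i\<in>gm_idx R. \<forall>g. is_identity_of (gm_prod R i i i) (D i g) (u i g)) \<and>
        (\<forall>g. is_identity_of (gm_matrix_mult R) (matrices_over R (ideal_entry R D g))
               (gm_diagonal_matrix R (\<lambda>i. u i g))))"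

end

theory Submission
  imports Defs
begin

text \<open>
  Both sides of the equivalence encode the same object, the locale \<open>partial_matrix_action\<close>: for
  every group element \<open>g\<close> a family of linear maps \<open>T_g\<close>, one on each entry of the matrix algebra,
  with

    \<open>T_0 = id\<close>,  \<open>T_g (m n) = (T_g m) (T_g n)\<close>,  \<open>e_g m = m e_g\<close>,  \<open>T_g (T_h m) = e_g T_(g + h) m\<close>,

  where \<open>e_g = T_g 1\<close> is the value at the unit of the diagonal algebra concerned.

  From \<open>T\<close> to a unital datum (\<open>unital_datum_corner\<close>): \<open>e_g\<close> is an idempotent commuting with all
  matrix entries, so it generates ideals, and \<open>T_g\<close> restricts to a bijection from \<open>e_(-g) M\<close> onto
  \<open>e_g M\<close> with inverse \<open>T_(-g)\<close>. On these subspaces the composition law becomes the domain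
  and composition conditions of a datum.

  From a unital datum to \<open>T\<close> (\<open>partial_matrix_action_extension\<close>): let \<open>u_g\<close> be the identity of the
  ideal of \<open>g\<close> and extend by zero, \<open>T_g m = \<gamma>_g (u_(-g) m)\<close>. The composition law rests on the
  fact that \<open>\<gamma>_g\<close> maps the identity \<open>u_(-g) u_l\<close> of an intersection of two ideals to the
  identity \<open>u_g u_(g + l)\<close> of its image (\<open>\<gamma>_u_prod\<close>).

  From \<open>T\<close> to the smash products: extend \<open>T\<close> linearly to the group algebra and let \<open>a # g\<close> act from
  the left by \<open>m \<mapsto> a (T_g m)\<close> and \<open>g # a\<close> from the right by \<open>m \<mapsto> (T_g m) a\<close>. Associativity of
  these actions is the composition law, whose idempotent \<open>e_g\<close> is absorbed by a factor \<open>T_g b\<close>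
  (\<open>left_act_mult\<close>, \<open>right_act_mult\<close>).

  From the smash products to \<open>T\<close> (\<open>partial_matrix_action_translation\<close>): \<open>T_g\<close> is the operator of
  \<open>1 # g\<close>. The composition law is the image of the identity
  \<open>(1 # g) (1 # h) = (e_g # 0) (1 # (g + h))\<close>, where \<open>0\<close> is the neutral group element, and
  multiplicativity is the compatibility of the modules with products, at group elements.
\<close>

section \<open>Linear extension from group elements\<close>

text \<open>
  The group elements are a basis of the group algebra, so a linear map out of it, or out of its
  tensor product with another space, is one such sum of linear maps \<open>f g\<close>.
\<close>

definition keys_sum :: "('g \<Rightarrow> 'a \<Rightarrow> 'b::comm_monoid_add) \<Rightarrow> ('g \<Rightarrow>\<^sub>0 'a::zero) \<Rightarrow> 'b" where
  "keys_sum f x = (\<Sum>g\<in>Poly_Mapping.keys x. f g (Poly_Mapping.lookup x g))"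

lemma keys_sum_zero [simp]: "keys_sum f 0 = 0"
  by (simp add: keys_sum_def)

lemma keys_sum_single: "f g 0 = 0 \<Longrightarrow> keys_sum f (Poly_Mapping.single g a) = f g a"
  by (simp add: keys_sum_def)

lemma keys_sum_add:
  assumes "\<And>g. f g 0 = 0"
    and "\<And>g. f g (Poly_Mapping.lookup x g + Poly_Mapping.lookup y g)
           = f g (Poly_Mapping.lookup x g) + f g (Poly_Mapping.lookup y g)"
  shows "keys_sum f (x + y) = keys_sum f x + keys_sum f y"
  unfolding keys_sum_def using assms by (intro setsum_keys_plus_distrib)

lemma lookup_map_zero:
  assumes "\<phi> 0 = 0"
  shows "Poly_Mapping.lookup (Poly_Mapping.map \<phi> x) g = \<phi> (Poly_Mapping.lookup x g)"
  using assms by (simp add: Poly_Mapping.map.rep_eq when_def)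

lemma keys_sum_map:
  assumes "\<And>g. f g 0 = 0" and "\<phi> 0 = 0"
  shows "keys_sum f (Poly_Mapping.map \<phi> x) = keys_sum (\<lambda>g a. f g (\<phi> a)) x"
proof -
  have "Poly_Mapping.keys (Poly_Mapping.map \<phi> x) \<subseteq> Poly_Mapping.keys x"
    using assms(2) by (auto simp: in_keys_iff lookup_map_zero)
  then show ?thesis
    unfolding keys_sum_def using assms
    by (intro sum.mono_neutral_cong_left) (auto simp: in_keys_iff lookup_map_zero)
qed

lemma lookup_sum_single_in:
  fixes a :: "'i \<Rightarrow> 'a::comm_monoid_add"
  assumes "0 \<in> V" and "\<And>x y. x \<in> V \<Longrightarrow> y \<in> V \<Longrightarrow> x + y \<in> V"
    and "\<And>i. i \<in> F \<Longrightarrow> a i \<in> V"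
  shows "Poly_Mapping.lookup (\<Sum>i\<in>F. Poly_Mapping.single (k i) (a i)) g \<in> V"
  using assms(3)
  by (induction F rule: infinite_finite_induct)
     (auto simp: lookup_add lookup_single when_def assms(1,2))

text \<open>
  The products in the smash products are sums of monomials whose group elements may coincide.
  Collecting equal ones is harmless where each \<open>f g\<close> is additive. Additivity is asked on a set
  \<open>V\<close> only, because the products of a generalized matrix algebra are bilinear only on its entries.
\<close>

lemma keys_sum_of_sum_single:
  fixes a :: "'i \<Rightarrow> 'a::comm_monoid_add"
  assumes V: "0 \<in> V" "\<And>x y. x \<in> V \<Longrightarrow> y \<in> V \<Longrightarrow> x + y \<in> V"
    and f0: "\<And>g. f g 0 = 0"
    and f_add: "\<And>g x y. x \<in> V \<Longrightarrow> y \<in> V \<Longrightarrow> f g (x + y) = f g x + f g y"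
    and a: "\<And>i. i \<in> F \<Longrightarrow> a i \<in> V"
  shows "keys_sum f (\<Sum>i\<in>F. Poly_Mapping.single (k i) (a i)) = (\<Sum>i\<in>F. f (k i) (a i))"
  using a
proof (induction F rule: infinite_finite_induct)
  case (insert i F)
  have "keys_sum f (Poly_Mapping.single (k i) (a i) + (\<Sum>i\<in>F. Poly_Mapping.single (k i) (a i)))
      = keys_sum f (Poly_Mapping.single (k i) (a i))
        + keys_sum f (\<Sum>i\<in>F. Poly_Mapping.single (k i) (a i))"
  proof (intro keys_sum_add f0 f_add)
    show "Poly_Mapping.lookup (Poly_Mapping.single (k i) (a i)) g \<in> V" for g
      using insert.prems V(1) by (simp add: lookup_single when_def)
    show "Poly_Mapping.lookup (\<Sum>i\<in>F. Poly_Mapping.single (k i) (a i)) g \<in> V" for g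
      using insert.prems by (intro lookup_sum_single_in V) auto
  qed
  with insert show ?case by (simp add: keys_sum_single f0)
qed auto

lemma keys_sum_of_double_sum_single:
  fixes a :: "'i \<Rightarrow> 'j \<Rightarrow> 'a::comm_monoid_add"
  assumes "0 \<in> V" "\<And>x y. x \<in> V \<Longrightarrow> y \<in> V \<Longrightarrow> x + y \<in> V"
    and "\<And>g. f g 0 = 0"
    and "\<And>g x y. x \<in> V \<Longrightarrow> y \<in> V \<Longrightarrow> f g (x + y) = f g x + f g y"
    and "\<And>i j. i \<in> F \<Longrightarrow> j \<in> G \<Longrightarrow> a i j \<in> V"
  shows "keys_sum f (\<Sum>i\<in>F. \<Sum>j\<in>G. Poly_Mapping.single (k i j) (a i j))
       = (\<Sum>i\<in>F. \<Sum>j\<in>G. f (k i j) (a i j))"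
  using keys_sum_of_sum_single[of V f "F \<times> G" "\<lambda>(i, j). a i j" "\<lambda>(i, j). k i j"] assms
  by (force simp: sum.cartesian_product case_prod_beta)

lemma sum_single_keys:
  fixes x :: "'g \<Rightarrow>\<^sub>0 'a::comm_monoid_add"
  shows "(\<Sum>g\<in>Poly_Mapping.keys x. Poly_Mapping.single g (Poly_Mapping.lookup x g)) = x"
  by (rule poly_mapping_eqI)
     (simp add: lookup_sum lookup_single when_def in_keys_iff)

lemma single_mult_eq_sum:
  fixes k :: "'g::monoid_add \<Rightarrow>\<^sub>0 'k::semiring_1"
  shows "Poly_Mapping.single g 1 * k
       = (\<Sum>l\<in>Poly_Mapping.keys k. Poly_Mapping.single (g + l) (Poly_Mapping.lookup k l))"
proof -
  have "Poly_Mapping.single g 1 * k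
      = Poly_Mapping.single g 1
        * (\<Sum>l\<in>Poly_Mapping.keys k. Poly_Mapping.single l (Poly_Mapping.lookup k l))"
    by (simp add: sum_single_keys)
  then show ?thesis by (simp add: sum_distrib_left mult_single)
qed

section \<open>Generalized matrix algebras\<close>

locale matrix_algebra =
  fixes R :: "('k::field, 'm::ab_group_add) gma"
  assumes gma: "generalized_matrix_algebra R"
begin

abbreviation I where "I \<equiv> gm_idx R"
abbreviation M where "M \<equiv> gm_entry R"
abbreviation P where "P \<equiv> gm_prod R"
abbreviation scl where "scl \<equiv> gm_scale R"
abbreviation one where "one \<equiv> gm_one R"

sublocale vs: vector_space scl
  using gma by (simp add: generalized_matrix_algebra_def)

lemma M_subspace [simp, intro]: "i \<in> I \<Longrightarrow> j \<in> I \<Longrightarrow> vs.subspace (M i j)"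
  using gma by (simp add: generalized_matrix_algebra_def)

lemma M_0 [simp, intro]: "i \<in> I \<Longrightarrow> j \<in> I \<Longrightarrow> 0 \<in> M i j"
  using M_subspace vs.subspace_0 by blast

lemma M_add [simp, intro]:
  "i \<in> I \<Longrightarrow> j \<in> I \<Longrightarrow> x \<in> M i j \<Longrightarrow> y \<in> M i j \<Longrightarrow> x + y \<in> M i j"
  using M_subspace vs.subspace_add by blast

lemma M_scale [simp, intro]: "i \<in> I \<Longrightarrow> j \<in> I \<Longrightarrow> x \<in> M i j \<Longrightarrow> scl c x \<in> M i j"
  using M_subspace vs.subspace_scale by blast

lemma M_sum [simp, intro]:
  "i \<in> I \<Longrightarrow> j \<in> I \<Longrightarrow> (\<And>a. a \<in> F \<Longrightarrow> f a \<in> M i j) \<Longrightarrow> sum f F \<in> M i j"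
  using M_subspace vs.subspace_sum by blast

lemma prod_bilinear:
  assumes "i \<in> I" "j \<in> I" "k \<in> I"
  shows "bilinear_on scl scl scl (M i j) (M j k) (M i k) (P i j k)"
  using assms gma by (simp add: generalized_matrix_algebra_def)

lemma prod_closed [simp, intro]:
  assumes "i \<in> I" "j \<in> I" "k \<in> I" "x \<in> M i j" "y \<in> M j k"
  shows "P i j k x y \<in> M i k"
  using prod_bilinear[OF assms(1-3)] assms by (simp add: bilinear_on_def linear_on_def)

lemma prod_add_right:
  assumes "i \<in> I" "j \<in> I" "k \<in> I" "x \<in> M i j" "y \<in> M j k" "y' \<in> M j k"
  shows "P i j k x (y + y') = P i j k x y + P i j k x y'"
  using prod_bilinear[OF assms(1-3)] assms by (simp add: bilinear_on_def linear_on_def)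

lemma prod_add_left:
  assumes "i \<in> I" "j \<in> I" "k \<in> I" "x \<in> M i j" "x' \<in> M i j" "y \<in> M j k"
  shows "P i j k (x + x') y = P i j k x y + P i j k x' y"
  using prod_bilinear[OF assms(1-3)] assms by (simp add: bilinear_on_def linear_on_def)

lemma prod_scale_right:
  assumes "i \<in> I" "j \<in> I" "k \<in> I" "x \<in> M i j" "y \<in> M j k"
  shows "P i j k x (scl c y) = scl c (P i j k x y)"
  using prod_bilinear[OF assms(1-3)] assms by (simp add: bilinear_on_def linear_on_def)

lemma prod_scale_left:
  assumes "i \<in> I" "j \<in> I" "k \<in> I" "x \<in> M i j" "y \<in> M j k"
  shows "P i j k (scl c x) y = scl c (P i j k x y)"
  using prod_bilinear[OF assms(1-3)] assms by (simp add: bilinear_on_def linear_on_def)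

lemma prod_zero_left [simp]:
  assumes "i \<in> I" "j \<in> I" "k \<in> I" "y \<in> M j k"
  shows "P i j k 0 y = 0"
  using prod_scale_left[OF assms(1-3) M_0 assms(4), of 0] assms by simp

lemma prod_zero_right [simp]:
  assumes "i \<in> I" "j \<in> I" "k \<in> I" "x \<in> M i j"
  shows "P i j k x 0 = 0"
  using prod_scale_right[OF assms(1-3) assms(4) M_0, of 0] assms by simp

lemma prod_sum_right:
  assumes "i \<in> I" "j \<in> I" "k \<in> I" "x \<in> M i j" "\<And>a. a \<in> F \<Longrightarrow> f a \<in> M j k"
  shows "P i j k x (sum f F) = (\<Sum>a\<in>F. P i j k x (f a))"
  using assms(5)
  by (induction F rule: infinite_finite_induct) (use assms(1-4) in \<open>auto simp: prod_add_right\<close>)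

lemma prod_sum_left:
  assumes "i \<in> I" "j \<in> I" "k \<in> I" "y \<in> M j k" "\<And>a. a \<in> F \<Longrightarrow> f a \<in> M i j"
  shows "P i j k (sum f F) y = (\<Sum>a\<in>F. P i j k (f a) y)"
  using assms(5)
  by (induction F rule: infinite_finite_induct) (use assms(1-4) in \<open>auto simp: prod_add_left\<close>)

lemma prod_assoc:
  assumes "i \<in> I" "j \<in> I" "k \<in> I" "l \<in> I" "x \<in> M i j" "y \<in> M j k" "z \<in> M k l"
  shows "P i k l (P i j k x y) z = P i j l x (P j k l y z)"
  using gma assms unfolding generalized_matrix_algebra_def by blast

lemma one_closed [simp, intro]: "i \<in> I \<Longrightarrow> one i \<in> M i i"
  using gma by (simp add: generalized_matrix_algebra_def gm_one_def linear_on_def)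

lemma one_left [simp]: "i \<in> I \<Longrightarrow> j \<in> I \<Longrightarrow> m \<in> M i j \<Longrightarrow> P i i j (one i) m = m"
  using gma by (simp add: generalized_matrix_algebra_def gm_one_def)

lemma one_right [simp]: "i \<in> I \<Longrightarrow> j \<in> I \<Longrightarrow> m \<in> M i j \<Longrightarrow> P i j j m (one j) = m"
  using gma by (simp add: generalized_matrix_algebra_def gm_one_def)

lemma diag_simps [simp]:
  "alg_scale (gm_diag R i) = scl" "alg_carrier (gm_diag R i) = M i i"
  "alg_mult (gm_diag R i) = P i i i" "alg_one (gm_diag R i) = one i"
  by (simp_all add: gm_diag_def)

text \<open>
  An identity element \<open>u\<close> of the ideal turns the span of products into the set of fixed points of
  \<open>u\<close>: all products are fixed, and a fixed point \<open>m = u m\<close> is itself a product.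
\<close>

lemma ideal_entry_eq:
  assumes ij: "i \<in> I" "j \<in> I" and "D i g \<subseteq> M i i" and "u \<in> D i g"
    and u: "\<And>d. d \<in> D i g \<Longrightarrow> P i i i u d = d"
  shows "ideal_entry R D g i j = {m \<in> M i j. P i i j u m = m}" (is "_ = ?E")
proof
  have uM: "u \<in> M i i" using assms by blast
  have "vs.subspace ?E"
    using ij uM by (auto intro!: vs.subspaceI simp: prod_add_right prod_scale_right)
  moreover have "P i i j d m \<in> ?E" if "d \<in> D i g" "m \<in> M i j" for d m
  proof -
    have "d \<in> M i i" using that assms by blast
    then have "P i i j u (P i i j d m) = P i i j (P i i i u d) m"
      using ij that uM by (simp add: prod_assoc)
    then show ?thesis using u \<open>d \<in> M i i\<close> that ij by simp
  qed
  ultimately show "ideal_entry R D g i j \<subseteq> ?E"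
    unfolding ideal_entry_def span_products_def by (intro vs.span_minimal) auto
  show "?E \<subseteq> ideal_entry R D g i j"
  proof
    fix m assume "m \<in> ?E"
    then show "m \<in> ideal_entry R D g i j"
      unfolding ideal_entry_def span_products_def using \<open>u \<in> D i g\<close>
      by (intro vs.span_base) force
  qed
qed

lemma entry_ideal_eq:
  assumes ij: "i \<in> I" "j \<in> I" and "D j g \<subseteq> M j j" and "u \<in> D j g"
    and u: "\<And>d. d \<in> D j g \<Longrightarrow> P j j j d u = d"
  shows "entry_ideal R D g i j = {m \<in> M i j. P i j j m u = m}" (is "_ = ?E")
proof
  have uM: "u \<in> M j j" using assms by blast
  have "vs.subspace ?E"
    using ij uM by (auto intro!: vs.subspaceI simp: prod_add_left prod_scale_left)
  moreover have "P i j j m d \<in> ?E" if "d \<in> D j g" "m \<in> M i j" for d m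
  proof -
    have "d \<in> M j j" using that assms by blast
    then show ?thesis using u that ij uM by (simp add: prod_assoc)
  qed
  ultimately show "entry_ideal R D g i j \<subseteq> ?E"
    unfolding entry_ideal_def span_products_def by (intro vs.span_minimal) auto
  show "?E \<subseteq> entry_ideal R D g i j"
  proof
    fix m assume "m \<in> ?E"
    then show "m \<in> entry_ideal R D g i j"
      unfolding entry_ideal_def span_products_def using \<open>u \<in> D j g\<close>
      by (intro vs.span_base) force
  qed
qed

end

section \<open>Partial actions by maps defined everywhere\<close>

text \<open>
  The common core of both sides of the equivalence: the maps of a unital datum, precomposed with
  multiplication by the identity element of their domain, so that they are defined on the whole
  of each entry; equally, the operators by which the elements \<open>1 # g\<close> of the smash products act.
  In \<open>T_T\<close> the composition law holds only up to the idempotent \<open>T i i g (one i)\<close>, which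
  records where the map of \<open>g\<close> takes its values.
\<close>

locale partial_matrix_action = matrix_algebra R
  for R :: "('k::field, 'm::ab_group_add) gma" +
  fixes T :: "nat \<Rightarrow> nat \<Rightarrow> 'g::group_add \<Rightarrow> 'm \<Rightarrow> 'm"
  assumes T_closed [simp, intro]: "i \<in> I \<Longrightarrow> j \<in> I \<Longrightarrow> m \<in> M i j \<Longrightarrow> T i j g m \<in> M i j"
    and T_add: "i \<in> I \<Longrightarrow> j \<in> I \<Longrightarrow> m \<in> M i j \<Longrightarrow> n \<in> M i j
                  \<Longrightarrow> T i j g (m + n) = T i j g m + T i j g n"
    and T_scale: "i \<in> I \<Longrightarrow> j \<in> I \<Longrightarrow> m \<in> M i j \<Longrightarrow> T i j g (scl c m) = scl c (T i j g m)"
    and T_neutral [simp]: "i \<in> I \<Longrightarrow> j \<in> I \<Longrightarrow> m \<in> M i j \<Longrightarrow> T i j 0 m = m"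
    and T_prod: "i \<in> I \<Longrightarrow> j \<in> I \<Longrightarrow> k \<in> I \<Longrightarrow> m \<in> M i j \<Longrightarrow> n \<in> M j k
                  \<Longrightarrow> T i k g (P i j k m n) = P i j k (T i j g m) (T j k g n)"
    and T_one_central: "i \<in> I \<Longrightarrow> j \<in> I \<Longrightarrow> m \<in> M i j
                  \<Longrightarrow> P i i j (T i i g (one i)) m = P i j j m (T j j g (one j))"
    and T_T: "i \<in> I \<Longrightarrow> j \<in> I \<Longrightarrow> m \<in> M i j
                  \<Longrightarrow> T i j g (T i j h m) = P i i j (T i i g (one i)) (T i j (g + h) m)"
begin

definition e :: "nat \<Rightarrow> 'g \<Rightarrow> 'm" where
  "e i g = T i i g (one i)"

lemma e_closed [simp, intro]: "i \<in> I \<Longrightarrow> e i g \<in> M i i"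
  by (simp add: e_def)

lemma T_0 [simp]: "i \<in> I \<Longrightarrow> j \<in> I \<Longrightarrow> T i j g 0 = 0"
  using T_scale[of i j 0 g 0] by simp

lemma T_sum:
  assumes "i \<in> I" "j \<in> I" "\<And>a. a \<in> F \<Longrightarrow> f a \<in> M i j"
  shows "T i j g (sum f F) = (\<Sum>a\<in>F. T i j g (f a))"
  using assms(3)
  by (induction F rule: infinite_finite_induct) (use assms(1,2) in \<open>auto simp: T_add\<close>)

lemma e_T [simp]:
  "i \<in> I \<Longrightarrow> j \<in> I \<Longrightarrow> m \<in> M i j \<Longrightarrow> P i i j (e i g) (T i j g m) = T i j g m"
  using T_prod[of i i j "one i" m g] by (simp add: e_def)

lemma T_e [simp]:
  "i \<in> I \<Longrightarrow> j \<in> I \<Longrightarrow> m \<in> M i j \<Longrightarrow> P i j j (T i j g m) (e j g) = T i j g m"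
  using T_prod[of i j j m "one j" g] by (simp add: e_def)

lemma e_central:
  "i \<in> I \<Longrightarrow> j \<in> I \<Longrightarrow> m \<in> M i j \<Longrightarrow> P i i j (e i g) m = P i j j m (e j g)"
  by (simp add: e_def T_one_central)

lemma e_neutral [simp]: "i \<in> I \<Longrightarrow> e i 0 = one i"
  by (simp add: e_def)

lemma e_idem [simp]: "i \<in> I \<Longrightarrow> P i i i (e i g) (e i g) = e i g"
  using e_T[of i i "one i" g] by (simp add: e_def)

text \<open>
  Idempotents of different group elements commute, as each one is central in the diagonal algebra.
\<close>

lemma e_swap:
  assumes "i \<in> I" "j \<in> I" "m \<in> M i j"
  shows "P i i j (e i g) (P i i j (e i h) m) = P i i j (e i h) (P i i j (e i g) m)"
  using prod_assoc[of i i i j "e i g" "e i h" m] prod_assoc[of i i i j "e i h" "e i g" m]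
    e_central[of i i "e i h" g] assms by simp

lemma T_comp:
  "i \<in> I \<Longrightarrow> j \<in> I \<Longrightarrow> m \<in> M i j \<Longrightarrow> T i j g (T i j h m) = P i i j (e i g) (T i j (g + h) m)"
  by (simp add: e_def T_T)

lemma T_comp_right:
  "i \<in> I \<Longrightarrow> j \<in> I \<Longrightarrow> m \<in> M i j \<Longrightarrow> T i j g (T i j h m) = P i j j (T i j (g + h) m) (e j g)"
  by (simp add: T_comp e_central)

lemma T_inverse: "i \<in> I \<Longrightarrow> j \<in> I \<Longrightarrow> m \<in> M i j \<Longrightarrow> T i j g (T i j (- g) m) = P i i j (e i g) m"
  by (simp add: T_comp)

lemma T_inverse': "i \<in> I \<Longrightarrow> j \<in> I \<Longrightarrow> m \<in> M i j \<Longrightarrow> T i j (- g) (T i j g m) = P i i j (e i (- g)) m"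
  by (simp add: T_comp)

end

context partial_matrix_action
begin

text \<open>
  The subspace cut out by the idempotent of \<open>g\<close>: the image of \<open>T i j g\<close>, and in a datum both
  the domain of the map of \<open>- g\<close> and the codomain of the map of \<open>g\<close>.
\<close>

definition corner :: "'g \<Rightarrow> nat \<Rightarrow> nat \<Rightarrow> 'm set" where
  "corner g i j = {m \<in> M i j. P i i j (e i g) m = m}"

lemma corner_subset: "m \<in> corner g i j \<Longrightarrow> m \<in> M i j"
  by (simp add: corner_def)

lemma T_in_corner [simp, intro]: "i \<in> I \<Longrightarrow> j \<in> I \<Longrightarrow> m \<in> M i j \<Longrightarrow> T i j g m \<in> corner g i j"
  by (simp add: corner_def)

lemma ideal_entry_corner:
  "i \<in> I \<Longrightarrow> j \<in> I \<Longrightarrow> ideal_entry R (\<lambda>i g. corner g i i) g i j = corner g i j"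
  by (subst ideal_entry_eq[where u = "e i g"]) (auto simp: corner_def)

lemma entry_ideal_corner:
  assumes "i \<in> I" "j \<in> I"
  shows "entry_ideal R (\<lambda>i g. corner g i i) g i j = corner g i j"
proof -
  have "P j j j d (e j g) = d" if "d \<in> corner g j j" for d
    using that assms e_central[of j j d g] by (simp add: corner_def)
  then have "entry_ideal R (\<lambda>i g. corner g i i) g i j = {m \<in> M i j. P i j j m (e j g) = m}"
    using assms by (subst entry_ideal_eq[where u = "e j g"]) (auto simp: corner_def)
  also have "\<dots> = corner g i j"
    using assms by (auto simp: corner_def e_central)
  finally show ?thesis .
qed

lemma corner_subspace: "i \<in> I \<Longrightarrow> j \<in> I \<Longrightarrow> vs.subspace (corner g i j)"
  unfolding corner_def by (rule vs.subspaceI) (auto simp: prod_add_right prod_scale_right)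

lemma corner_neutral: "i \<in> I \<Longrightarrow> j \<in> I \<Longrightarrow> corner 0 i j = M i j"
  by (auto simp: corner_def)

lemma T_bij_corner:
  assumes "i \<in> I" "j \<in> I"
  shows "bij_betw (T i j g) (corner (- g) i j) (corner g i j)"
proof (rule bij_betw_byWitness[where f' = "T i j (- g)"])
  show "\<forall>a\<in>corner (- g) i j. T i j (- g) (T i j g a) = a"
    using assms by (auto simp: corner_def T_inverse')
  show "\<forall>a\<in>corner g i j. T i j g (T i j (- g) a) = a"
    using assms by (auto simp: corner_def T_inverse)
qed (use assms in \<open>auto dest: corner_subset\<close>)

lemma T_linear_corner:
  "i \<in> I \<Longrightarrow> j \<in> I \<Longrightarrow> linear_on scl scl (corner (- g) i j) (corner g i j) (T i j g)"
  by (auto simp: linear_on_def T_add T_scale corner_subset)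

lemma T_prod_corner:
  "i \<in> I \<Longrightarrow> j \<in> I \<Longrightarrow> k \<in> I \<Longrightarrow> m \<in> corner h i j \<Longrightarrow> n \<in> corner h' j k
     \<Longrightarrow> T i k g (P i j k m n) = P i j k (T i j g m) (T j k g n)"
  by (simp add: T_prod corner_def)

text \<open>
  Pull \<open>T_h a = e_(-g) T_h a\<close> back along \<open>T_(-h)\<close>, writing \<open>e_g\<close> for the idempotent of \<open>g\<close>.
  Multiplicativity turns the factor into
  \<open>T_(-h) e_(-g) = T_(-h) (T_(-g) 1) = e_(-h) e_(-(g + h))\<close>, and \<open>e_(-h)\<close> fixes \<open>a\<close>.
\<close>

lemma corner_transport:
  assumes "i \<in> I" "j \<in> I" "a \<in> corner (- h) i j" "T i j h a \<in> corner (- g) i j"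
  shows "a \<in> corner (- (g + h)) i j"
proof -
  have aM: "a \<in> M i j" using assms(3) by (rule corner_subset)
  have eq: "T i i (- h) (e i (- g)) = P i i i (e i (- h)) (e i (- (g + h)))"
    using assms(1) by (simp add: e_def T_T minus_add)
  have "a = T i j (- h) (T i j h a)"
    using assms aM by (simp add: T_inverse' corner_def)
  also have "\<dots> = T i j (- h) (P i i j (e i (- g)) (T i j h a))"
    using assms(4) by (simp add: corner_def)
  also have "\<dots> = P i i j (T i i (- h) (e i (- g))) a"
    using assms(1-3) aM by (simp add: T_prod T_inverse' corner_def)
  also have "\<dots> = P i i j (e i (- (g + h))) a"
    using assms(1-3) aM
    by (simp add: eq prod_assoc e_swap[of i j a "- h"]) (simp add: corner_def)
  finally show ?thesis using aM by (simp add: corner_def)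
qed

text \<open>
  The composition law leaves the idempotent \<open>e_g\<close> of \<open>g\<close> as a factor:
  \<open>T_g (T_h a) = e_g T_(g + h) a\<close>. Here it acts as the identity: as \<open>a = T_(-h) (T_h a)\<close>, the same law gives
  \<open>T_(g + h) a = e_(g + h) T_g (T_h a)\<close>, and \<open>e_g\<close> fixes the right-hand side.
\<close>

lemma T_comp_corner:
  assumes "i \<in> I" "j \<in> I" "a \<in> corner (- h) i j" "T i j h a \<in> corner (- g) i j"
  shows "T i j g (T i j h a) = T i j (g + h) a"
proof -
  have aM: "a \<in> M i j" using assms(3) by (rule corner_subset)
  have "T i j (g + h) a = T i j (g + h) (T i j (- h) (T i j h a))"
    using assms aM by (simp add: T_inverse' corner_def)
  also have "\<dots> = P i i j (e i (g + h)) (T i j g (T i j h a))"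
    using assms(1,2) aM by (simp add: T_comp[of i j "T i j h a" "g + h"] add.assoc)
  also have "\<dots> = P i i j (e i g) (T i j (g + h) a)"
    using assms(1,2) aM by (simp add: T_comp e_swap[of i j _ "g + h" g])
  finally show ?thesis using assms(1,2) aM by (simp add: T_comp)
qed

lemma corner_ideal:
  assumes "i \<in> I"
  shows "two_sided_ideal (gm_diag R i) (corner g i i)"
proof -
  have "P i i i a d \<in> corner g i i \<and> P i i i d a \<in> corner g i i"
    if a: "a \<in> M i i" and d: "d \<in> corner g i i" for a d
  proof -
    have dM: "d \<in> M i i" and ed: "P i i i (e i g) d = d"
      using d by (simp_all add: corner_def)
    have "P i i i (e i g) (P i i i a d) = P i i i (P i i i a (e i g)) d"
      using assms a dM by (simp add: prod_assoc[symmetric] e_central)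
    moreover have "P i i i (e i g) (P i i i d a) = P i i i d a"
      using assms a dM ed prod_assoc[of i i i i "e i g" d a] by simp
    ultimately show ?thesis
      using assms a dM ed by (simp add: corner_def prod_assoc)
  qed
  then show ?thesis
    using assms by (auto simp: two_sided_ideal_def corner_subspace dest: corner_subset)
qed

lemma partial_group_action_corner:
  assumes i: "i \<in> I"
  shows "partial_group_action (gm_diag R i) (\<lambda>g. corner g i i) (T i i)"
  unfolding partial_group_action_def diag_simps
  using i by (auto simp: corner_ideal T_linear_corner T_bij_corner T_prod_corner corner_neutral
      corner_transport T_comp_corner dest: corner_subset)

lemma diagonal_e_identity:
  "is_identity_of (gm_matrix_mult R) (matrices_over R (corner g))
     (gm_diagonal_matrix R (\<lambda>i. e i g))"
proof -
  have fin: "finite I" by (simp add: gm_idx_def)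
  let ?E = "gm_diagonal_matrix R (\<lambda>i. e i g)"
  have "?E \<in> matrices_over R (corner g)"
    by (auto simp: matrices_over_def gm_diagonal_matrix_def corner_def)
  moreover have "gm_matrix_mult R ?E x = x \<and> gm_matrix_mult R x ?E = x"
    if x: "x \<in> matrices_over R (corner g)" for x
  proof -
    have xc: "x i j \<in> corner g i j" if "i \<in> I" "j \<in> I" for i j
      using x that by (simp add: matrices_over_def)
    have xM: "x i j \<in> M i j" if "i \<in> I" "j \<in> I" for i j
      using xc[OF that] by (rule corner_subset)
    have l: "(\<Sum>k\<in>I. P i k j (?E i k) (x k j)) = x i j" if "i \<in> I" "j \<in> I" for i j
    proof -
      have "(\<Sum>k\<in>I. P i k j (?E i k) (x k j)) = (\<Sum>k\<in>I. if i = k then x i j else 0)"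
        using that xc xM by (intro sum.cong) (auto simp: gm_diagonal_matrix_def corner_def)
      then show ?thesis using fin that by simp
    qed
    have r: "(\<Sum>k\<in>I. P i k j (x i k) (?E k j)) = x i j" if "i \<in> I" "j \<in> I" for i j
    proof -
      have "P i j j (x i j) (e j g) = x i j"
        using xc[OF that] xM[OF that] that e_central[of i j "x i j" g] by (simp add: corner_def)
      then have "(\<Sum>k\<in>I. P i k j (x i k) (?E k j)) = (\<Sum>k\<in>I. if k = j then x i j else 0)"
        using that xc xM by (intro sum.cong) (auto simp: gm_diagonal_matrix_def)
      then show ?thesis using fin that by simp
    qed
    show ?thesis
      using x by (auto simp: gm_matrix_mult_def l r matrices_over_def intro!: ext)
  qed
  ultimately show ?thesis by (simp add: is_identity_of_def)
qed

lemma unital_datum_corner: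
  "unital_datum R (\<lambda>i g. corner g i i) (\<lambda>i. T i i) (\<lambda>g i j. T i j g)"
proof -
  have "matrices_over R (ideal_entry R (\<lambda>i g. corner g i i) g) = matrices_over R (corner g)" for g
    by (auto simp: matrices_over_def ideal_entry_corner)
  moreover have "is_identity_of (P i i i) (corner g i i) (e i g)" if "i \<in> I" for i g
    using that e_central[of i i _ g] by (auto simp: is_identity_of_def corner_def)
  moreover have "datum R (\<lambda>i g. corner g i i) (\<lambda>i. T i i) (\<lambda>g i j. T i j g)"
    unfolding datum_def
    by (auto simp: ideal_entry_corner entry_ideal_corner partial_group_action_corner T_linear_corner
        T_bij_corner T_prod_corner corner_transport T_comp_corner dest: corner_subset)
  ultimately show ?thesis
    unfolding unital_datum_def by (auto simp: diagonal_e_identity intro!: exI[of _ e])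
qed

end

section \<open>From a unital datum to maps defined everywhere\<close>

locale unital_matrix_datum = matrix_algebra R
  for R :: "('k::field, 'm::ab_group_add) gma" +
  fixes D :: "nat \<Rightarrow> 'g::group_add \<Rightarrow> 'm set"
    and \<alpha> :: "nat \<Rightarrow> 'g \<Rightarrow> 'm \<Rightarrow> 'm"
    and \<gamma> :: "'g \<Rightarrow> nat \<Rightarrow> nat \<Rightarrow> 'm \<Rightarrow> 'm"
    and u :: "nat \<Rightarrow> 'g \<Rightarrow> 'm"
  assumes datum: "datum R D \<alpha> \<gamma>"
    and identity: "i \<in> I \<Longrightarrow> is_identity_of (P i i i) (D i g) (u i g)"
begin

abbreviation E where "E g i j \<equiv> ideal_entry R D g i j"

text \<open>
  The conditions of a datum are selected by position: once its symmetry condition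
  \<open>ideal_entry = entry_ideal\<close> is among the facts, simplification rewrites away the ideals that the
  other conditions speak of.
\<close>

lemmas datum_action = datum[unfolded datum_def, THEN conjunct1]
  and datum_after_action = datum[unfolded datum_def, THEN conjunct2]
lemmas datum_symmetric = datum_after_action[THEN conjunct1]
  and datum_after_symmetric = datum_after_action[THEN conjunct2]
lemmas datum_linear_bij = datum_after_symmetric[THEN conjunct1]
  and datum_after_diagonal = datum_after_symmetric[THEN conjunct2, THEN conjunct2]
lemmas datum_neutral = datum_after_diagonal[THEN conjunct1]
  and datum_after_neutral = datum_after_diagonal[THEN conjunct2]
lemmas datum_prod = datum_after_neutral[THEN conjunct1]
  and datum_domain = datum_after_neutral[THEN conjunct2, THEN conjunct1]
  and datum_comp = datum_after_neutral[THEN conjunct2, THEN conjunct2]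

lemma D_action: "i \<in> I \<Longrightarrow> partial_group_action (gm_diag R i) (D i) (\<alpha> i)"
  using datum_action by blast

lemma D_subset: "i \<in> I \<Longrightarrow> D i g \<subseteq> M i i"
  using D_action by (simp add: partial_group_action_def two_sided_ideal_def)

lemma u_D: "i \<in> I \<Longrightarrow> u i g \<in> D i g"
  using identity by (simp add: is_identity_of_def)

lemma u_closed [simp, intro]: "i \<in> I \<Longrightarrow> u i g \<in> M i i"
  using u_D D_subset by blast

lemma mem_E: "i \<in> I \<Longrightarrow> j \<in> I \<Longrightarrow> m \<in> E g i j \<longleftrightarrow> m \<in> M i j \<and> P i i j (u i g) m = m"
  using identity[of i g] D_subset[of i g]
  by (subst ideal_entry_eq[where u = "u i g"]) (auto simp: is_identity_of_def)

lemma mem_E': "i \<in> I \<Longrightarrow> j \<in> I \<Longrightarrow> m \<in> E g i j \<longleftrightarrow> m \<in> M i j \<and> P i j j m (u j g) = m"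
proof -
  assume ij: "i \<in> I" "j \<in> I"
  then have "E g i j = entry_ideal R D g i j" using datum_symmetric by blast
  then show ?thesis
    using ij identity[of j g] D_subset[of j g]
    by (subst (asm) entry_ideal_eq[where u = "u j g"]) (auto simp: is_identity_of_def)
qed

lemma E_closed: "i \<in> I \<Longrightarrow> j \<in> I \<Longrightarrow> m \<in> E g i j \<Longrightarrow> m \<in> M i j"
  by (simp add: mem_E)

lemma u_fixes: "i \<in> I \<Longrightarrow> j \<in> I \<Longrightarrow> m \<in> E g i j \<Longrightarrow> P i i j (u i g) m = m"
  by (simp add: mem_E)

lemma fixes_u: "i \<in> I \<Longrightarrow> j \<in> I \<Longrightarrow> m \<in> E g i j \<Longrightarrow> P i j j m (u j g) = m"
  by (simp add: mem_E')

lemma u_idem [simp]: "i \<in> I \<Longrightarrow> P i i i (u i g) (u i g) = u i g"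
  using identity[of i g] by (simp add: is_identity_of_def)

lemma E_prod_right:
  assumes "i \<in> I" "j \<in> I" "k \<in> I" "m \<in> E g i j" "n \<in> M j k"
  shows "P i j k m n \<in> E g i k"
  using assms prod_assoc[of i i j k "u i g" m n] by (simp add: mem_E)

lemma E_prod_left:
  assumes "i \<in> I" "j \<in> I" "k \<in> I" "m \<in> M i j" "n \<in> E g j k"
  shows "P i j k m n \<in> E g i k"
  using assms prod_assoc[of i j k k m n "u k g"] by (simp add: mem_E')

lemma u_E [simp, intro]: "i \<in> I \<Longrightarrow> u i g \<in> E g i i"
  by (simp add: mem_E)

lemma u_prod_E [simp, intro]: "i \<in> I \<Longrightarrow> j \<in> I \<Longrightarrow> m \<in> M i j \<Longrightarrow> P i i j (u i g) m \<in> E g i j"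
  by (simp add: E_prod_right)

text \<open>
  Both \<open>u m\<close> and \<open>m u\<close> lie in the common ideal, where \<open>u\<close> is an identity on either side, so
  both are equal to \<open>u m u\<close>.
\<close>

lemma u_central:
  assumes "i \<in> I" "j \<in> I" "m \<in> M i j"
  shows "P i i j (u i g) m = P i j j m (u j g)"
proof -
  have "P i i j (u i g) m = P i j j (P i i j (u i g) m) (u j g)"
    using assms by (simp add: fixes_u)
  also have "\<dots> = P i i j (u i g) (P i j j m (u j g))"
    using assms by (simp add: prod_assoc)
  also have "\<dots> = P i j j m (u j g)"
    using assms by (intro u_fixes E_prod_left) auto
  finally show ?thesis .
qed

lemma u_neutral: "i \<in> I \<Longrightarrow> u i 0 = one i"
proof -
  assume i: "i \<in> I"
  then have "one i \<in> D i 0" using D_action[of i] by (simp add: partial_group_action_def)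
  then have "P i i i (u i 0) (one i) = one i"
    using identity[OF i, of 0] by (simp add: is_identity_of_def)
  then show ?thesis using i by simp
qed

lemma \<gamma>_linear: "i \<in> I \<Longrightarrow> j \<in> I \<Longrightarrow> linear_on scl scl (E (- g) i j) (E g i j) (\<gamma> g i j)"
  using datum_linear_bij by blast

lemma \<gamma>_bij: "i \<in> I \<Longrightarrow> j \<in> I \<Longrightarrow> bij_betw (\<gamma> g i j) (E (- g) i j) (E g i j)"
  using datum_linear_bij by blast

lemma \<gamma>_E: "i \<in> I \<Longrightarrow> j \<in> I \<Longrightarrow> m \<in> E (- g) i j \<Longrightarrow> \<gamma> g i j m \<in> E g i j"
  using \<gamma>_linear by (simp add: linear_on_def)

lemma \<gamma>_closed: "i \<in> I \<Longrightarrow> j \<in> I \<Longrightarrow> m \<in> E (- g) i j \<Longrightarrow> \<gamma> g i j m \<in> M i j"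
  using \<gamma>_E E_closed by blast

lemma \<gamma>_prod:
  "i \<in> I \<Longrightarrow> j \<in> I \<Longrightarrow> k \<in> I \<Longrightarrow> m \<in> E (- g) i j \<Longrightarrow> n \<in> E (- g) j k
     \<Longrightarrow> P i j k (\<gamma> g i j m) (\<gamma> g j k n) = \<gamma> g i k (P i j k m n)"
  using datum_prod by blast

lemma \<gamma>_neutral: "i \<in> I \<Longrightarrow> j \<in> I \<Longrightarrow> m \<in> M i j \<Longrightarrow> \<gamma> 0 i j m = m"
  using datum_neutral by blast

lemma \<gamma>_comp:
  assumes "i \<in> I" "j \<in> I" "a \<in> E (- h) i j" "\<gamma> h i j a \<in> E (- g) i j"
  shows "\<gamma> g i j (\<gamma> h i j a) = \<gamma> (g + h) i j a"
  using datum_comp assms \<gamma>_E[of i j a h] by blast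

lemma \<gamma>_inverse:
  assumes "i \<in> I" "j \<in> I" "a \<in> E (- g) i j"
  shows "\<gamma> (- g) i j (\<gamma> g i j a) = a"
  using \<gamma>_comp[of i j a g "- g"] assms by (simp add: \<gamma>_E \<gamma>_neutral E_closed)

text \<open>
  This is the domain condition of a datum for the pair \<open>- (g + l)\<close>, \<open>g\<close>, as
  \<open>- (- (g + l) + g) = l\<close>.
\<close>

lemma E_transport_back:
  assumes "i \<in> I" "j \<in> I" "a \<in> E (- g) i j" "\<gamma> g i j a \<in> E (g + l) i j"
  shows "a \<in> E l i j"
proof -
  have "a \<in> E (- (- (g + l) + g)) i j"
    using datum_domain assms \<gamma>_E[of i j a g] by force
  then show ?thesis by (simp add: minus_add add.assoc)
qed

text \<open>
  The converse inclusion is the domain condition applied to \<open>\<gamma> (- g)\<close>, the inverse of \<open>\<gamma> g\<close>.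
\<close>

lemma E_transport:
  assumes "i \<in> I" "j \<in> I" "a \<in> E (- g) i j" "a \<in> E l i j"
  shows "\<gamma> g i j a \<in> E (g + l) i j"
proof (rule E_transport_back[where g = "- g"])
  show "\<gamma> g i j a \<in> E (- (- g)) i j" using assms by (simp add: \<gamma>_E)
  show "\<gamma> (- g) i j (\<gamma> g i j a) \<in> E (- g + (g + l)) i j"
    using assms by (simp add: \<gamma>_inverse add.assoc[symmetric])
qed (use assms in auto)

lemma u_swap:
  assumes "i \<in> I" "j \<in> I" "m \<in> M i j"
  shows "P i i j (u i g) (P i i j (u i h) m) = P i i j (u i h) (P i i j (u i g) m)"
  using prod_assoc[of i i i j "u i g" "u i h" m] prod_assoc[of i i i j "u i h" "u i g" m]
    u_central[of i i "u i h" g] assms by simp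

text \<open>
  By the two inclusions above, \<open>\<gamma> g\<close> restricts to an algebra isomorphism from the intersection of
  the ideals of \<open>- g\<close> and \<open>l\<close> onto that of the ideals of \<open>g\<close> and \<open>g + l\<close>; an isomorphism
  preserves identity elements, and the identity of an intersection is the product of the identities.
\<close>

lemma \<gamma>_u_prod:
  assumes i: "i \<in> I"
  shows "\<gamma> g i i (P i i i (u i (- g)) (u i l)) = P i i i (u i g) (u i (g + l))"
proof -
  let ?p = "P i i i (u i (- g)) (u i l)" and ?q = "P i i i (u i g) (u i (g + l))"
  have p: "?p \<in> E (- g) i i" "?p \<in> E l i i" and q: "?q \<in> E g i i" "?q \<in> E (g + l) i i"
    using i by (auto intro: E_prod_left)
  have \<gamma>p: "\<gamma> g i i ?p \<in> E g i i" "\<gamma> g i i ?p \<in> E (g + l) i i" "\<gamma> g i i ?p \<in> M i i"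
    using i p by (simp_all add: \<gamma>_E E_transport \<gamma>_closed)
  obtain a where a: "a \<in> E (- g) i i" "?q = \<gamma> g i i a"
    using \<gamma>_bij[OF i i, of g] q(1) unfolding bij_betw_def by blast
  have "a \<in> E l i i" using E_transport_back[OF i i a(1)] a(2) q(2) by simp
  then have pa: "P i i i ?p a = a"
    using a i by (simp add: prod_assoc u_fixes E_closed)
  have "?q = \<gamma> g i i (P i i i ?p a)" using a pa by simp
  also have "\<dots> = P i i i (\<gamma> g i i ?p) ?q" using i p a by (simp add: \<gamma>_prod)
  also have "\<dots> = \<gamma> g i i ?p"
    using i \<gamma>p by (simp add: prod_assoc[symmetric] fixes_u)
  finally show ?thesis by simp
qed

lemma \<gamma>_u: "i \<in> I \<Longrightarrow> \<gamma> g i i (u i (- g)) = u i g"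
  using \<gamma>_u_prod[of i g 0] by (simp add: u_neutral)

text \<open>
  Since \<open>u\<close> projects onto the domain of \<open>\<gamma>\<close>, this is \<open>\<gamma>\<close> extended by zero.
\<close>

definition extension :: "nat \<Rightarrow> nat \<Rightarrow> 'g \<Rightarrow> 'm \<Rightarrow> 'm" where
  "extension i j g m = \<gamma> g i j (P i i j (u i (- g)) m)"

lemma extension_one: "i \<in> I \<Longrightarrow> extension i i g (one i) = u i g"
  by (simp add: extension_def \<gamma>_u)

text \<open>
  The element \<open>u_(-g) \<gamma>_h (u_(-h) m)\<close> is the image under \<open>\<gamma>_h\<close> of
  \<open>a = u_(-h) u_(-(g + h)) m\<close>, because \<open>\<gamma>_h\<close> maps \<open>u_(-h) u_(-(g + h))\<close> to \<open>u_h u_(-g)\<close>. So the left-hand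
  side is \<open>\<gamma>_(g + h) a\<close>, and \<open>\<gamma>_(g + h)\<close> maps the factor \<open>u_(-(g + h)) u_(-h)\<close> of \<open>a\<close> to
  \<open>u_(g + h) u_g\<close>.
\<close>

lemma extension_comp:
  assumes ij: "i \<in> I" "j \<in> I" and m: "m \<in> M i j"
  shows "extension i j g (extension i j h m) = P i i j (u i g) (extension i j (g + h) m)"
proof -
  let ?l = "- (g + h)"
  have l: "h + ?l = - g" by (simp add: minus_add add_diff_eq)
  \<comment> \<open>Repeating an idempotent lets \<open>a\<close> split into two factors that both lie in a domain of \<open>\<gamma>\<close>.\<close>
  define a where "a = P i i j (P i i i (u i (- h)) (u i ?l)) (P i i j (u i (- h)) m)"
  have a': "a = P i i j (P i i i (u i ?l) (u i (- h))) (P i i j (u i ?l) m)"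
    unfolding a_def using ij m u_swap[of i j m "- h" ?l]
      prod_assoc[of i i i j "u i (-h)" "u i (-h)" m] prod_assoc[of i i i j "u i ?l" "u i ?l" m]
      u_swap[of i j "P i i j (u i (- h)) m" "- h" ?l] u_swap[of i j "P i i j (u i ?l) m" "- h" ?l]
    by (simp add: prod_assoc)
  have aE: "a \<in> E (- h) i j"
    unfolding a_def using ij m by (intro E_prod_right) auto
  have "P i i j (u i (- g)) (\<gamma> h i j (P i i j (u i (- h)) m))
      = P i i j (P i i i (u i h) (u i (- g))) (\<gamma> h i j (P i i j (u i (- h)) m))"
    using ij m u_swap[of i j "\<gamma> h i j (P i i j (u i (- h)) m)" h "- g"]
    by (simp add: prod_assoc \<gamma>_closed u_fixes[OF _ _ \<gamma>_E])
  also have "\<dots> = \<gamma> h i j a"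
    using ij m \<gamma>_u_prod[of i h ?l] unfolding l a_def
    by (simp add: \<gamma>_prod[symmetric] E_prod_right)
  finally have w: "P i i j (u i (- g)) (\<gamma> h i j (P i i j (u i (- h)) m)) = \<gamma> h i j a" .
  moreover have "\<gamma> h i j a \<in> E (- g) i j"
    unfolding w[symmetric] using ij m by (simp add: \<gamma>_closed)
  ultimately have "extension i j g (extension i j h m) = \<gamma> (g + h) i j a"
    unfolding extension_def using ij aE by (simp add: \<gamma>_comp)
  also have "\<dots> = P i i j (\<gamma> (g + h) i i (P i i i (u i ?l) (u i (- h))))
                       (extension i j (g + h) m)"
    unfolding a' extension_def using ij m by (subst \<gamma>_prod) (auto intro: E_prod_right)
  also have "\<dots> = P i i j (P i i i (u i (g + h)) (u i g)) (extension i j (g + h) m)"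
    using ij \<gamma>_u_prod[of i "g + h" "- h"] by (simp add: add.assoc)
  also have "\<dots> = P i i j (u i g) (extension i j (g + h) m)"
    unfolding extension_def
    using ij m u_swap[of i j "\<gamma> (g + h) i j (P i i j (u i ?l) m)" "g + h" g]
    by (simp add: prod_assoc \<gamma>_closed u_fixes[OF _ _ \<gamma>_E])
  finally show ?thesis .
qed

lemma extension_prod:
  assumes "i \<in> I" "j \<in> I" "k \<in> I" "m \<in> M i j" "n \<in> M j k"
  shows "extension i k g (P i j k m n) = P i j k (extension i j g m) (extension j k g n)"
proof -
  have "P i j k (P i i j (u i (- g)) m) (P j j k (u j (- g)) n)
      = P i j k (P i j j (P i i j (u i (- g)) m) (u j (- g))) n"
    using assms by (simp add: prod_assoc)
  also have "\<dots> = P i i k (u i (- g)) (P i j k m n)"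
    using assms fixes_u[of i j "P i i j (u i (- g)) m" "- g"] by (simp add: prod_assoc)
  finally show ?thesis
    using assms by (simp add: extension_def \<gamma>_prod)
qed

lemma partial_matrix_action_extension: "partial_matrix_action R extension"
proof
  fix i j g m n c
  assume ij: "i \<in> I" "j \<in> I" "m \<in> M i j"
  show "extension i j g m \<in> M i j"
    using ij by (simp add: extension_def \<gamma>_closed)
  show "extension i j g (scl c m) = scl c (extension i j g m)"
    using ij \<gamma>_linear[of i j g] by (simp add: extension_def linear_on_def prod_scale_right)
  show "extension i j 0 m = m"
    using ij by (simp add: extension_def u_neutral \<gamma>_neutral)
  show "P i i j (extension i i g (one i)) m = P i j j m (extension j j g (one j))"
    using ij by (simp add: extension_one u_central)
  show "extension i j g (extension i j h m)
      = P i i j (extension i i g (one i)) (extension i j (g + h) m)" for h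
    using ij by (simp add: extension_one extension_comp)
  assume "n \<in> M i j"
  then show "extension i j g (m + n) = extension i j g m + extension i j g n"
    using ij \<gamma>_linear[of i j g] by (simp add: extension_def linear_on_def prod_add_right)
qed (simp add: extension_prod)

end

section \<open>Partial smash products in coordinates\<close>

lemma sweedler_keys_sum:
  "sweedler s h B
     = keys_sum (\<lambda>g c. s c (B (Poly_Mapping.single g 1) (Poly_Mapping.single g 1))) h"
  by (simp add: sweedler_def keys_sum_def)

context matrix_algebra
begin

lemma tensor_diag_single [simp]:
  "tensor (gm_diag R i) a (Poly_Mapping.single g c) = Poly_Mapping.single g (scl c a)"
  by (simp add: tensor_def)

lemma pm_scale_single [simp]:
  "pm_scale scl c (Poly_Mapping.single g a) = Poly_Mapping.single g (scl c a)"
  by (simp add: pm_scale_def)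

lemma left_smash_mult_eq:
  "left_smash_mult (gm_diag R i) act x y =
     (\<Sum>g\<in>Poly_Mapping.keys x. \<Sum>l\<in>Poly_Mapping.keys y. Poly_Mapping.single (g + l)
        (P i i i (Poly_Mapping.lookup x g)
          (act (Poly_Mapping.single g 1) (Poly_Mapping.lookup y l))))"
  by (simp add: left_smash_mult_def sweedler_def mult_single)

lemma right_smash_mult_eq:
  "right_smash_mult (gm_diag R i) ract x y =
     (\<Sum>g\<in>Poly_Mapping.keys x. \<Sum>l\<in>Poly_Mapping.keys y. Poly_Mapping.single (l + g)
        (P i i i (ract (Poly_Mapping.lookup x g) (Poly_Mapping.single l 1))
          (Poly_Mapping.lookup y l)))"
  by (simp add: right_smash_mult_def sweedler_def mult_single op_mult_def)

lemma left_smash_elem_eq: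
  "left_smash_elem (gm_diag R i) act a h =
     (\<Sum>g\<in>Poly_Mapping.keys h. Poly_Mapping.single g
        (scl (Poly_Mapping.lookup h g) (P i i i a (act (Poly_Mapping.single g 1) (one i)))))"
  by (simp add: left_smash_elem_def sweedler_def)

lemma right_smash_elem_eq:
  "right_smash_elem (gm_diag R i) ract h a =
     (\<Sum>g\<in>Poly_Mapping.keys h. Poly_Mapping.single g
        (scl (Poly_Mapping.lookup h g) (P i i i (ract (one i) (Poly_Mapping.single g 1)) a)))"
  by (simp add: right_smash_elem_def sweedler_def)

lemma tensor_diag_one: "tensor (gm_diag R i) a 1 = Poly_Mapping.single 0 a"
  by (simp flip: single_one)

end

section \<open>From partial matrix actions to modules over the smash products\<close>

context partial_matrix_action
begin

text \<open>
  Defined on every entry: on the diagonal this is the partial action, and on any entry it is the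
  operator by which \<open>1 # h\<close> and \<open>h # 1\<close> act.
\<close>

definition act :: "nat \<Rightarrow> nat \<Rightarrow> ('g \<Rightarrow>\<^sub>0 'k) \<Rightarrow> 'm \<Rightarrow> 'm" where
  "act i j h m = keys_sum (\<lambda>g c. scl c (T i j g m)) h"

text \<open>
  The actions of the two smash products: \<open>a # g\<close> acts by \<open>m \<mapsto> a (T_g m)\<close> from the left, and
  \<open>g # a\<close> by \<open>m \<mapsto> (T_g m) a\<close> from the right.
\<close>

definition left_act :: "nat \<Rightarrow> nat \<Rightarrow> ('g \<Rightarrow>\<^sub>0 'm) \<Rightarrow> 'm \<Rightarrow> 'm" where
  "left_act i j x m = keys_sum (\<lambda>g a. P i i j a (T i j g m)) x"

definition right_act :: "nat \<Rightarrow> nat \<Rightarrow> 'm \<Rightarrow> ('g \<Rightarrow>\<^sub>0 'm) \<Rightarrow> 'm" where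
  "right_act i j m x = keys_sum (\<lambda>g a. P i j j (T i j g m) a) x"

lemma act_single [simp]: "act i j (Poly_Mapping.single g c) m = scl c (T i j g m)"
  by (simp add: act_def keys_sum_single)

lemma act_one [simp]: "i \<in> I \<Longrightarrow> j \<in> I \<Longrightarrow> m \<in> M i j \<Longrightarrow> act i j 1 m = m"
  by (simp flip: single_one)

lemma act_closed [simp, intro]: "i \<in> I \<Longrightarrow> j \<in> I \<Longrightarrow> m \<in> M i j \<Longrightarrow> act i j h m \<in> M i j"
  by (auto simp: act_def keys_sum_def)

lemma act_prod:
  assumes "i \<in> I" "j \<in> I" "k \<in> I" "m \<in> M i j" "n \<in> M j k"
  shows "act i k h (P i j k m n) = sweedler scl h (\<lambda>h1 h2. P i j k (act i j h1 m) (act j k h2 n))"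
  using assms by (simp add: sweedler_keys_sum act_def[of _ _ h] T_prod)

lemma act_single_mult:
  "act i i (Poly_Mapping.single g 1 * k) a = keys_sum (\<lambda>l c. scl c (T i i (g + l) a)) k"
  unfolding act_def single_mult_eq_sum
  by (subst keys_sum_of_sum_single[where V = UNIV])
     (auto simp: vs.scale_left_distrib keys_sum_def)

lemma act_bilinear:
  assumes "i \<in> I"
  shows "bilinear_on (pm_scale (*)) scl scl UNIV (M i i) (M i i) (act i i)"
proof -
  have "act i i (h + k) a = act i i h a + act i i k a" for h k a
    unfolding act_def by (intro keys_sum_add) (simp_all add: vs.scale_left_distrib)
  moreover have "act i i (pm_scale (*) c h) a = scl c (act i i h a)" for c h a
    unfolding act_def pm_scale_def
    by (subst keys_sum_map) (simp_all add: keys_sum_def vs.scale_sum_right)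
  moreover have "act i i h (scl c a) = scl c (act i i h a)" if "a \<in> M i i" for h c a
    using assms that
    by (simp add: act_def keys_sum_def T_scale vs.scale_sum_right mult.commute)
  moreover have "act i i h (a + b) = act i i h a + act i i h b" if "a \<in> M i i" "b \<in> M i i" for h a b
    using assms that
    by (simp add: act_def keys_sum_def T_add vs.scale_right_distrib sum.distrib)
  ultimately show ?thesis
    using assms by (simp add: bilinear_on_def linear_on_def)
qed

text \<open>
  The composition law for \<open>T\<close>, extended linearly in \<open>h\<close> and \<open>k\<close>. Moving the central idempotent
  to the other side gives the second form of the law for partial actions.
\<close>

lemma act_act:
  assumes "i \<in> I" "a \<in> M i i"
  shows "act i i h (act i i k a)
    = keys_sum (\<lambda>g c. scl c (P i i i (e i g) (act i i (Poly_Mapping.single g 1 * k) a))) h"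
proof -
  have "T i i g (act i i k a) = P i i i (e i g) (act i i (Poly_Mapping.single g 1 * k) a)" for g
  proof -
    have "T i i g (act i i k a)
        = (\<Sum>l\<in>Poly_Mapping.keys k. scl (Poly_Mapping.lookup k l) (T i i g (T i i l a)))"
      using assms by (simp add: act_def keys_sum_def T_sum T_scale)
    also have "\<dots> = P i i i (e i g) (act i i (Poly_Mapping.single g 1 * k) a)"
      using assms by (simp add: act_single_mult keys_sum_def prod_sum_right prod_scale_right T_comp)
    finally show ?thesis .
  qed
  then show ?thesis by (simp add: act_def keys_sum_def)
qed

lemma left_partial_action_act:
  assumes i: "i \<in> I"
  shows "left_partial_action (gm_diag R i) (act i i)"
proof -
  have "act i i h (act i i k a)
      = sweedler scl h (\<lambda>h1 h2. P i i i (act i i h1 (one i)) (act i i (h2 * k) a))"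
    and "act i i h (act i i k a)
      = sweedler scl h (\<lambda>h1 h2. P i i i (act i i (h1 * k) a) (act i i h2 (one i)))"
    if "a \<in> M i i" for h k a
    using i that e_central[of i i "act i i _ a"]
    by (simp_all add: act_act sweedler_keys_sum flip: e_def)
  then show ?thesis
    unfolding left_partial_action_def diag_simps using i act_bilinear act_prod by simp
qed

lemma left_act_sum_single:
  assumes "i \<in> I" "j \<in> I" "m \<in> M i j" "\<And>p. p \<in> F \<Longrightarrow> a p \<in> M i i"
  shows "left_act i j (\<Sum>p\<in>F. Poly_Mapping.single (k p) (a p)) m
       = (\<Sum>p\<in>F. P i i j (a p) (T i j (k p) m))"
  unfolding left_act_def using assms
  by (intro keys_sum_of_sum_single[where V = "M i i"]) (auto simp: prod_add_left)

lemma left_act_double_sum_single: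
  assumes "i \<in> I" "j \<in> I" "m \<in> M i j" "\<And>p q. p \<in> F \<Longrightarrow> q \<in> G \<Longrightarrow> a p q \<in> M i i"
  shows "left_act i j (\<Sum>p\<in>F. \<Sum>q\<in>G. Poly_Mapping.single (k p q) (a p q)) m
       = (\<Sum>p\<in>F. \<Sum>q\<in>G. P i i j (a p q) (T i j (k p q) m))"
  unfolding left_act_def using assms
  by (intro keys_sum_of_double_sum_single[where V = "M i i"]) (auto simp: prod_add_left)

lemma right_act_sum_single:
  assumes "i \<in> I" "j \<in> I" "m \<in> M i j" "\<And>p. p \<in> F \<Longrightarrow> a p \<in> M j j"
  shows "right_act i j m (\<Sum>p\<in>F. Poly_Mapping.single (k p) (a p))
       = (\<Sum>p\<in>F. P i j j (T i j (k p) m) (a p))"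
  unfolding right_act_def using assms
  by (intro keys_sum_of_sum_single[where V = "M j j"]) (auto simp: prod_add_right)

lemma right_act_double_sum_single:
  assumes "i \<in> I" "j \<in> I" "m \<in> M i j" "\<And>p q. p \<in> F \<Longrightarrow> q \<in> G \<Longrightarrow> a p q \<in> M j j"
  shows "right_act i j m (\<Sum>p\<in>F. \<Sum>q\<in>G. Poly_Mapping.single (k p q) (a p q))
       = (\<Sum>p\<in>F. \<Sum>q\<in>G. P i j j (T i j (k p q) m) (a p q))"
  unfolding right_act_def using assms
  by (intro keys_sum_of_double_sum_single[where V = "M j j"]) (auto simp: prod_add_right)

lemma lookup_left_smash:
  assumes "i \<in> I" "x \<in> alg_carrier (left_smash (gm_diag R i) (act i i))"
  shows "Poly_Mapping.lookup x g \<in> M i i"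
proof -
  obtain y where y: "\<And>g. Poly_Mapping.lookup y g \<in> M i i"
    and x: "x = left_smash_mult (gm_diag R i) (act i i) y (Poly_Mapping.single 0 (one i))"
    using assms(2) by (auto simp: left_smash_def tensor_diag_one tensor_space_def)
  show ?thesis
    unfolding x left_smash_mult_eq sum.cartesian_product case_prod_beta using assms(1) y
    by (intro lookup_sum_single_in) (auto simp: lookup_single when_def)
qed

lemma lookup_right_smash:
  assumes "i \<in> I" "x \<in> alg_carrier (right_smash (gm_diag R i) (induced_right_action (act i i)))"
  shows "Poly_Mapping.lookup x g \<in> M i i"
proof -
  obtain y where y: "\<And>g. Poly_Mapping.lookup y g \<in> M i i"
    and x: "x = right_smash_mult (gm_diag R i) (induced_right_action (act i i))
                  (Poly_Mapping.single 0 (one i)) y"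
    using assms(2) by (auto simp: right_smash_def tensor_diag_one tensor_space_def)
  show ?thesis
    unfolding x right_smash_mult_eq sum.cartesian_product case_prod_beta using assms(1) y
    by (intro lookup_sum_single_in) (auto simp: lookup_single when_def induced_right_action_def)
qed

lemma left_act_elem:
  assumes "i \<in> I" "j \<in> I" "a \<in> M i i" "m \<in> M i j"
  shows "left_act i j (left_smash_elem (gm_diag R i) (act i i) a h) m
       = P i i j a (act i j h m)"
  using assms unfolding left_smash_elem_eq
  by (subst left_act_sum_single)
     (auto simp: act_def[of _ _ h] keys_sum_def prod_sum_right prod_scale_right prod_scale_left prod_assoc
        simp flip: e_def)

lemma right_act_elem:
  assumes "i \<in> I" "j \<in> I" "a \<in> M j j" "m \<in> M i j"
  shows "right_act i j m (right_smash_elem (gm_diag R j) (induced_right_action (act j j)) h a)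
       = P i j j (act i j h m) a"
  using assms unfolding right_smash_elem_eq
  by (subst right_act_sum_single)
     (auto simp: act_def[of _ _ h] keys_sum_def prod_sum_left prod_scale_right prod_scale_left prod_assoc[symmetric]
        induced_right_action_def simp flip: e_def)

text \<open>
  For \<open>a \<otimes> g\<close> and \<open>b \<otimes> l\<close> both sides equal \<open>a (T_g b) (T_(g + l) m)\<close>: the idempotent \<open>e_g\<close>
  that composing \<open>T_g\<close> with \<open>T_l\<close> leaves behind is absorbed by \<open>T_g b\<close>. Both sides
  are additive in each tensor, so monomials suffice.
\<close>

lemma left_act_mult:
  assumes ij: "i \<in> I" "j \<in> I" and m: "m \<in> M i j"
    and x: "\<And>g. Poly_Mapping.lookup x g \<in> M i i" and y: "\<And>g. Poly_Mapping.lookup y g \<in> M i i"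
  shows "left_act i j (left_smash_mult (gm_diag R i) (act i i) x y) m
       = left_act i j x (left_act i j y m)"
proof -
  have "P i i j (P i i i a (T i i g b)) (T i j (g + l) m) = P i i j a (T i j g (P i i j b (T i j l m)))"
    if "a \<in> M i i" "b \<in> M i i" for a b g l
  proof -
    have "T i j g (P i i j b (T i j l m))
        = P i i j (P i i i (T i i g b) (e i g)) (T i j (g + l) m)"
      using ij m that(2) by (simp add: T_prod T_comp prod_assoc del: T_e)
    then show ?thesis using ij m that by (simp add: prod_assoc)
  qed
  then show ?thesis
    unfolding left_smash_mult_eq using ij m x y
    by (subst left_act_double_sum_single)
       (auto simp: left_act_def keys_sum_def T_sum prod_sum_right)
qed

text \<open>
  For \<open>g \<otimes> a\<close> and \<open>l \<otimes> b\<close> both sides equal \<open>(T_(l + g) m) (T_l a) b\<close>. The second element acts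
  last on \<open>m\<close>, hence from the left of \<open>g\<close>, which is why the right smash product has to be formed
  over the opposite group algebra.
\<close>

lemma right_act_mult:
  assumes ij: "i \<in> I" "j \<in> I" and m: "m \<in> M i j"
    and x: "\<And>g. Poly_Mapping.lookup x g \<in> M j j" and y: "\<And>g. Poly_Mapping.lookup y g \<in> M j j"
  shows "right_act i j m (right_smash_mult (gm_diag R j) (induced_right_action (act j j)) x y)
       = right_act i j (right_act i j m x) y"
proof -
  have "P i j j (T i j (l + g) m) (P j j j (T j j l a) b) = P i j j (T i j l (P i j j (T i j g m) a)) b"
    if "a \<in> M j j" "b \<in> M j j" for a b g l
  proof -
    have "T i j l (P i j j (T i j g m) a)
        = P i j j (T i j (l + g) m) (P j j j (e j l) (T j j l a))"
      using ij m that(1) by (simp add: T_prod T_comp_right prod_assoc del: e_T)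
    then show ?thesis using ij m that by (simp add: prod_assoc)
  qed
  then show ?thesis
    unfolding right_smash_mult_eq using ij m x y
    by (subst right_act_double_sum_single, simp_all add: induced_right_action_def)
       (subst sum.swap, simp add: right_act_def keys_sum_def T_sum prod_sum_left)
qed

lemma left_module_left_act:
  assumes ij: "i \<in> I" "j \<in> I"
  shows "left_module (left_smash (gm_diag R i) (act i i)) scl (M i j) (left_act i j)"
proof -
  let ?A = "left_smash (gm_diag R i) (act i i)"
  have sel: "alg_scale ?A = pm_scale scl" "alg_mult ?A = left_smash_mult (gm_diag R i) (act i i)"
    "alg_one ?A = left_smash_elem (gm_diag R i) (act i i) (one i) 1"
    by (simp_all add: left_smash_def)
  have lk: "Poly_Mapping.lookup x g \<in> M i i" if "x \<in> alg_carrier ?A" for x g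
    using lookup_left_smash[OF ij(1) that] .
  have "left_act i j x m \<in> M i j"
    and "left_act i j x (scl c m) = scl c (left_act i j x m)"
    if "x \<in> alg_carrier ?A" "m \<in> M i j" for x m c
    using ij lk[OF that(1)] that(2)
    by (auto simp: left_act_def keys_sum_def T_scale prod_scale_right
        prod_scale_left vs.scale_sum_right)
  moreover have "left_act i j (pm_scale scl c x) m = scl c (left_act i j x m)"
    if "x \<in> alg_carrier ?A" "m \<in> M i j" for x m c
    unfolding left_act_def pm_scale_def using ij lk[OF that(1)] that(2)
    by (subst keys_sum_map) (simp_all add: keys_sum_def prod_scale_left vs.scale_sum_right)
  moreover have "left_act i j x (m + n) = left_act i j x m + left_act i j x n"
    if "x \<in> alg_carrier ?A" "m \<in> M i j" "n \<in> M i j" for x m n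
    using ij lk[OF that(1)] that(2,3)
    by (simp add: left_act_def keys_sum_def T_add prod_add_right sum.distrib)
  moreover have "left_act i j (x + y) m = left_act i j x m + left_act i j y m"
    if "x \<in> alg_carrier ?A" "y \<in> alg_carrier ?A" "m \<in> M i j" for x y m
    unfolding left_act_def using ij lk[OF that(1)] lk[OF that(2)] that(3)
    by (intro keys_sum_add) (simp_all add: prod_add_left)
  ultimately show ?thesis
    unfolding left_module_def bilinear_on_def linear_on_def sel
    using ij lk by (simp add: left_act_mult left_act_elem keys_sum_single flip: single_one)
qed

lemma right_module_right_act:
  assumes ij: "i \<in> I" "j \<in> I"
  shows "right_module (right_smash (gm_diag R j) (induced_right_action (act j j))) scl (M i j)
           (right_act i j)"
proof -
  let ?A = "right_smash (gm_diag R j) (induced_right_action (act j j))"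
  have sel: "alg_scale ?A = pm_scale scl"
    "alg_mult ?A = right_smash_mult (gm_diag R j) (induced_right_action (act j j))"
    "alg_one ?A = right_smash_elem (gm_diag R j) (induced_right_action (act j j)) 1 (one j)"
    by (simp_all add: right_smash_def)
  have lk: "Poly_Mapping.lookup x g \<in> M j j" if "x \<in> alg_carrier ?A" for x g
    using lookup_right_smash[OF ij(2) that] .
  have "right_act i j m x \<in> M i j"
    and "right_act i j (scl c m) x = scl c (right_act i j m x)"
    if "x \<in> alg_carrier ?A" "m \<in> M i j" for x m c
    using ij lk[OF that(1)] that(2)
    by (auto simp: right_act_def keys_sum_def T_scale prod_scale_right
        prod_scale_left vs.scale_sum_right)
  moreover have "right_act i j m (pm_scale scl c x) = scl c (right_act i j m x)"
    if "x \<in> alg_carrier ?A" "m \<in> M i j" for x m c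
    unfolding right_act_def pm_scale_def using ij lk[OF that(1)] that(2)
    by (subst keys_sum_map) (simp_all add: keys_sum_def prod_scale_right vs.scale_sum_right)
  moreover have "right_act i j (m + n) x = right_act i j m x + right_act i j n x"
    if "x \<in> alg_carrier ?A" "m \<in> M i j" "n \<in> M i j" for x m n
    using ij lk[OF that(1)] that(2,3)
    by (simp add: right_act_def keys_sum_def T_add prod_add_left sum.distrib)
  moreover have "right_act i j m (x + y) = right_act i j m x + right_act i j m y"
    if "x \<in> alg_carrier ?A" "y \<in> alg_carrier ?A" "m \<in> M i j" for x y m
    unfolding right_act_def using ij lk[OF that(1)] lk[OF that(2)] that(3)
    by (intro keys_sum_add) (simp_all add: prod_add_right)
  ultimately show ?thesis
    unfolding right_module_def bilinear_on_def linear_on_def sel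
    using ij lk by (simp add: right_act_mult right_act_elem keys_sum_single flip: single_one)
qed

end

section \<open>From modules over the smash products to maps defined everywhere\<close>

context matrix_algebra
begin

lemma left_smash_mult_single:
  assumes "i \<in> I" "a \<in> M i i" "b \<in> M i i"
    and act: "\<And>b. b \<in> M i i \<Longrightarrow> act (Poly_Mapping.single g 1) b \<in> M i i"
    and act0: "act (Poly_Mapping.single g 1) 0 = 0"
  shows "left_smash_mult (gm_diag R i) act (Poly_Mapping.single g a) (Poly_Mapping.single l b)
       = Poly_Mapping.single (g + l) (P i i i a (act (Poly_Mapping.single g 1) b))"
  using assms by (cases "a = 0"; cases "b = 0") (auto simp: left_smash_mult_eq)

end

locale left_smash_modules = matrix_algebra R
  for R :: "('k::field, 'm::ab_group_add) gma" +
  fixes act :: "nat \<Rightarrow> ('g::group_add \<Rightarrow>\<^sub>0 'k) \<Rightarrow> 'm \<Rightarrow> 'm"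
    and L :: "nat \<Rightarrow> nat \<Rightarrow> ('g \<Rightarrow>\<^sub>0 'm) \<Rightarrow> 'm \<Rightarrow> 'm"
  assumes action: "i \<in> I \<Longrightarrow> left_partial_action (gm_diag R i) (act i)"
    and act_one_central: "i \<in> I \<Longrightarrow> j \<in> I \<Longrightarrow> m \<in> M i j \<Longrightarrow>
      P i i j (act i (Poly_Mapping.single g 1) (one i)) m
      = P i j j m (act j (Poly_Mapping.single g 1) (one j))"
    and L_module: "i \<in> I \<Longrightarrow> j \<in> I \<Longrightarrow>
      left_module (left_smash (gm_diag R i) (act i)) scl (M i j) (L i j)"
    and L_diag: "i \<in> I \<Longrightarrow> r \<in> M i i \<Longrightarrow>
      L i i (left_smash_elem (gm_diag R i) (act i) (one i) h) r = act i h r"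
    and L_scalar: "i \<in> I \<Longrightarrow> j \<in> I \<Longrightarrow> r \<in> M i i \<Longrightarrow> m \<in> M i j \<Longrightarrow>
      L i j (left_smash_elem (gm_diag R i) (act i) r 1) m = P i i j r m"
    and L_prod: "i \<in> I \<Longrightarrow> j \<in> I \<Longrightarrow> k \<in> I \<Longrightarrow> m \<in> M i j \<Longrightarrow> n \<in> M j k \<Longrightarrow>
      L i k (left_smash_elem (gm_diag R i) (act i) (one i) h) (P i j k m n)
      = sweedler scl h (\<lambda>h1 h2. P i j k
          (L i j (left_smash_elem (gm_diag R i) (act i) (one i) h1) m)
          (L j k (left_smash_elem (gm_diag R j) (act j) (one j) h2) n))"
begin

abbreviation grp :: "'g \<Rightarrow> 'g \<Rightarrow>\<^sub>0 'k" where "grp g \<equiv> Poly_Mapping.single g 1"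

lemma act_closed: "i \<in> I \<Longrightarrow> a \<in> M i i \<Longrightarrow> act i h a \<in> M i i"
  using action[of i] by (simp add: left_partial_action_def bilinear_on_def linear_on_def)

lemma act_zero: "i \<in> I \<Longrightarrow> act i h 0 = 0"
proof -
  assume i: "i \<in> I"
  then have "act i h (scl 0 0) = scl 0 (act i h 0)"
    using action[of i] unfolding left_partial_action_def bilinear_on_def linear_on_def diag_simps
    by blast
  then show ?thesis by simp
qed

lemma act_neutral: "i \<in> I \<Longrightarrow> a \<in> M i i \<Longrightarrow> act i 1 a = a"
  using action[of i] by (simp add: left_partial_action_def)

lemma act_act_one:
  assumes "i \<in> I"
  shows "act i (grp g) (act i (grp h) (one i))
       = P i i i (act i (grp g) (one i)) (act i (grp (g + h)) (one i))"
proof -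
  have "act i (grp g) (act i (grp h) (one i)) = sweedler scl (grp g)
      (\<lambda>h1 h2. P i i i (act i h1 (one i)) (act i (h2 * grp h) (one i)))"
    using action[OF assms] assms by (simp add: left_partial_action_def)
  then show ?thesis by (simp add: sweedler_keys_sum keys_sum_single mult_single)
qed

lemma elem_grp:
  "left_smash_elem (gm_diag R i) (act i) a (grp g)
     = Poly_Mapping.single g (P i i i a (act i (grp g) (one i)))"
  by (simp add: left_smash_elem_eq)

lemma elem_grp_carrier:
  assumes "i \<in> I" "a \<in> M i i"
  shows "left_smash_elem (gm_diag R i) (act i) a (grp g)
       \<in> alg_carrier (left_smash (gm_diag R i) (act i))"
proof -
  have "left_smash_elem (gm_diag R i) (act i) a (grp g)
      = left_smash_mult (gm_diag R i) (act i) (Poly_Mapping.single g a) (tensor (gm_diag R i) (one i) 1)"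
    using assms by (simp add: elem_grp tensor_diag_one left_smash_mult_single act_closed act_zero)
  moreover have "Poly_Mapping.single g a \<in> tensor_space (gm_diag R i)"
    using assms by (simp add: tensor_space_def lookup_single when_def)
  ultimately show ?thesis by (auto simp: left_smash_def)
qed

text \<open>
  Write \<open>e_g\<close> for the value of \<open>g\<close> at the unit, so that \<open>1 # g = e_g \<otimes> g\<close>. As \<open>g\<close> takes \<open>e_h\<close> to
  \<open>e_g e_(g + h)\<close> and \<open>e_g\<close> is idempotent, both sides are \<open>e_g e_(g + h) \<otimes> (g + h)\<close>. The module
  axioms turn this identity into the composition law.
\<close>

lemma elem_mult:
  assumes i: "i \<in> I"
  shows "left_smash_mult (gm_diag R i) (act i)
      (left_smash_elem (gm_diag R i) (act i) (one i) (grp g))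
      (left_smash_elem (gm_diag R i) (act i) (one i) (grp h))
    = left_smash_mult (gm_diag R i) (act i)
      (left_smash_elem (gm_diag R i) (act i) (act i (grp g) (one i)) 1)
      (left_smash_elem (gm_diag R i) (act i) (one i) (grp (g + h)))"
proof -
  let ?e = "\<lambda>g. act i (grp g) (one i)"
  have "act i (grp g) (P i i i (one i) (one i))
      = sweedler scl (grp g) (\<lambda>h1 h2. P i i i (act i h1 (one i)) (act i h2 (one i)))"
    using action[OF i] one_closed[OF i] unfolding left_partial_action_def diag_simps by blast
  then have "P i i i (?e g) (?e g) = ?e g"
    using i by (simp add: sweedler_keys_sum keys_sum_single)
  then have "P i i i (?e g) (P i i i (?e g) (?e (g + h))) = P i i i (?e g) (?e (g + h))"
    using i prod_assoc[of i i i i "?e g" "?e g" "?e (g + h)"] by (simp add: act_closed)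
  then show ?thesis
    using i elem_grp[of i "?e g" 0]
    by (simp add: elem_grp left_smash_mult_single act_closed act_zero act_act_one act_neutral)
qed

definition translation :: "nat \<Rightarrow> nat \<Rightarrow> 'g \<Rightarrow> 'm \<Rightarrow> 'm" where
  "translation i j g m = L i j (left_smash_elem (gm_diag R i) (act i) (one i) (grp g)) m"

lemma translation_one: "i \<in> I \<Longrightarrow> translation i i g (one i) = act i (grp g) (one i)"
  by (simp add: translation_def L_diag)

lemma L_mult:
  assumes "i \<in> I" "j \<in> I" "m \<in> M i j"
    and "x \<in> alg_carrier (left_smash (gm_diag R i) (act i))"
    and "y \<in> alg_carrier (left_smash (gm_diag R i) (act i))"
  shows "L i j (left_smash_mult (gm_diag R i) (act i) x y) m = L i j x (L i j y m)"
  using L_module[of i j] assms by (auto simp: left_module_def left_smash_def)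

lemma translation_comp:
  assumes "i \<in> I" "j \<in> I" "m \<in> M i j" "\<And>g. translation i j g m \<in> M i j"
  shows "translation i j g (translation i j h m)
       = P i i j (act i (grp g) (one i)) (translation i j (g + h) m)"
  unfolding translation_def
  using assms elem_mult[of i g h] elem_grp_carrier[of i "act i (grp g) (one i)" 0]
  by (subst L_mult[symmetric])
     (simp_all add: elem_grp_carrier L_mult act_closed L_scalar translation_def)

lemma partial_matrix_action_translation: "partial_matrix_action R translation"
proof
  fix i j g m n c
  assume ij: "i \<in> I" "j \<in> I" "m \<in> M i j"
  note lin = L_module[OF ij(1,2), unfolded left_module_def bilinear_on_def linear_on_def]
    elem_grp_carrier[OF ij(1) one_closed[OF ij(1)]]
  show closed: "translation i j g m \<in> M i j" for g
    unfolding translation_def using lin ij(3) by blast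
  show "translation i j g (scl c m) = scl c (translation i j g m)"
    unfolding translation_def using lin ij(3) by blast
  show "translation i j 0 m = m"
    using ij by (simp add: translation_def L_scalar)
  show "P i i j (translation i i g (one i)) m = P i j j m (translation j j g (one j))"
    using ij by (simp add: translation_one act_one_central)
  show "translation i j g (translation i j h m)
      = P i i j (translation i i g (one i)) (translation i j (g + h) m)" for h
    using ij closed by (simp add: translation_one translation_comp)
  assume "n \<in> M i j"
  then show "translation i j g (m + n) = translation i j g m + translation i j g n"
    unfolding translation_def using lin ij(3) by blast
next
  fix i j k g m n
  assume "i \<in> I" "j \<in> I" "k \<in> I" "m \<in> M i j" "n \<in> M j k"
  then show "translation i k g (P i j k m n) = P i j k (translation i j g m) (translation j k g n)"
    by (simp add: translation_def L_prod sweedler_def)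
qed

end

section \<open>The equivalence\<close>

theorem theorem4p17:
  fixes R :: "('k::field, 'm::ab_group_add) gma"
  assumes "generalized_matrix_algebra R"
    and "gm_size R > 0"
  shows
    "(\<exists>(D :: nat \<Rightarrow> 'g::group_add \<Rightarrow> 'm set) (\<alpha> :: nat \<Rightarrow> 'g \<Rightarrow> 'm \<Rightarrow> 'm)
        (\<gamma> :: 'g \<Rightarrow> nat \<Rightarrow> nat \<Rightarrow> 'm \<Rightarrow> 'm). unital_datum R D \<alpha> \<gamma>)
     \<longleftrightarrow>
     (\<exists>act :: nat \<Rightarrow> ('g \<Rightarrow>\<^sub>0 'k) \<Rightarrow> 'm \<Rightarrow> 'm.
        (\<forall>i\<in>gm_idx R. left_partial_action (gm_diag R i) (act i)) \<and>
        (\<forall>g. \<forall>i\<in>gm_idx R. \<forall>j\<in>gm_idx R. \<forall>m\<in>gm_entry R i j.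
           gm_prod R i i j (act i (Poly_Mapping.single g 1) (gm_one R i)) m =
           gm_prod R i j j m (act j (Poly_Mapping.single g 1) (gm_one R j))) \<and>
        (\<exists>(L :: nat \<Rightarrow> nat \<Rightarrow> ('g \<Rightarrow>\<^sub>0 'm) \<Rightarrow> 'm \<Rightarrow> 'm) (Q :: nat \<Rightarrow> nat \<Rightarrow> 'm \<Rightarrow> ('g \<Rightarrow>\<^sub>0 'm) \<Rightarrow> 'm).
           (\<forall>i\<in>gm_idx R. \<forall>j\<in>gm_idx R.
              left_module (left_smash (gm_diag R i) (act i)) (gm_scale R) (gm_entry R i j) (L i j) \<and>
              right_module (right_smash (gm_diag R j) (induced_right_action (act j)))
                (gm_scale R) (gm_entry R i j) (Q i j) \<and>
              (\<forall>h. \<forall>m\<in>gm_entry R i j.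
                 L i j (left_smash_elem (gm_diag R i) (act i) (gm_one R i) h) m =
                 Q i j m (right_smash_elem (gm_diag R j) (induced_right_action (act j)) h (gm_one R j))) \<and>
              (\<forall>h. \<forall>r\<in>gm_entry R i i.
                 L i i (left_smash_elem (gm_diag R i) (act i) (gm_one R i) h) r = act i h r) \<and>
              (\<forall>r\<in>gm_entry R i i. \<forall>m\<in>gm_entry R i j.
                 L i j (left_smash_elem (gm_diag R i) (act i) r 1) m = gm_prod R i i j r m) \<and>
              (\<forall>r\<in>gm_entry R j j. \<forall>m\<in>gm_entry R i j.
                 Q i j m (right_smash_elem (gm_diag R j) (induced_right_action (act j)) 1 r) =
                 gm_prod R i j j m r)) \<and>
           (\<forall>i\<in>gm_idx R. \<forall>j\<in>gm_idx R. \<forall>k\<in>gm_idx R. \<forall>h.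
              \<forall>m\<in>gm_entry R i j. \<forall>n\<in>gm_entry R j k.
                L i k (left_smash_elem (gm_diag R i) (act i) (gm_one R i) h) (gm_prod R i j k m n) =
                sweedler (gm_scale R) h (\<lambda>h1 h2.
                  gm_prod R i j k
                    (L i j (left_smash_elem (gm_diag R i) (act i) (gm_one R i) h1) m)
                    (L j k (left_smash_elem (gm_diag R j) (act j) (gm_one R j) h2) n)))))"
  (is "?datum \<longleftrightarrow> ?smash")
proof -
  interpret matrix_algebra R using assms(1) by unfold_locales
  show ?thesis
  proof
    assume ?datum
    then obtain D \<alpha> \<gamma> u where "datum R D \<alpha> (\<gamma> :: 'g \<Rightarrow> _)"
      and "\<forall>i\<in>I. \<forall>g. is_identity_of (P i i i) (D i g) (u i g)"
      unfolding unital_datum_def by blast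
    then interpret unital_matrix_datum R D \<alpha> \<gamma> u by unfold_locales auto
    interpret T: partial_matrix_action R extension by (rule partial_matrix_action_extension)
    show ?smash
    proof (intro exI[of _ "\<lambda>i. T.act i i"] conjI exI[of _ T.left_act] exI[of _ T.right_act])
    qed (simp_all add: T.left_partial_action_act T.T_one_central T.left_module_left_act
        T.right_module_right_act T.left_act_elem T.right_act_elem flip: T.act_prod)
  next
    assume ?smash
    then show ?datum
    proof (elim exE conjE, goal_cases)
      case (1 act L Q)
      note modules = 1(3)[rule_format]
      \<comment> \<open>The conditions are used as introduction rules: as rewrite rules, the equality of the two
        actions would replace the operators of the left module by those of the right one.\<close>
      note action = 1(1)[rule_format] and central = 1(2)[rule_format] and prod = 1(4)[rule_format]
      note left = modules[THEN conjunct1]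
        and formulas = modules[THEN conjunct2, THEN conjunct2, THEN conjunct2]
      note diag = formulas[THEN conjunct1, rule_format]
        and scalar = formulas[THEN conjunct2, THEN conjunct1, rule_format]
      interpret left_smash_modules R act L
        by unfold_locales
          (rule action central left diag scalar prod; assumption)+
      interpret T: partial_matrix_action R translation by (rule partial_matrix_action_translation)
      show ?case using T.unital_datum_corner by blast
    qed
  qed
qed

end
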